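(* Let $G$ be a graph on vertex set $[n]$ and let $v_i$ be a vertex of $G$ of degree $n-1$. Then the unipolar complex $\Delta_{G(v_i)}$ of $G$ at $v_i$ has a convex ear decomposition.
   Context: The coloring complex $\Delta_G$ of a graph $G$ on vertex set $[n]$ is the simplicial complex whose faces are ordered lists $S_1|\cdots|S_{r-1}$ of nonempty pairwise disjoint subsets of $[n]$ with $\bigcup_j S_j\neq[n]$ and at least one $S_j$ containing both endpoints of an edge of $G$ (faces ordered by refinement; equivalently chains $S_1\subset S_1\cup S_2\subset\cdots$ in the Boolean lattice). The unipolar complex $\Delta_{G(v_i)}$ is the subcomplex of $\Delta_G$ consisting of the faces $S_1|\cdots|S_{r-1}$ with $v_i\notin\bigcup_{j=1}^{r-1}S_j$. A convex ear decomposition of a $(d-1)$-dimensional simplicial complex $\Delta$ is an ordered sequence $\Delta_1,\dots,\Delta_m$ of pure $(d-1)$-dimensional subcomplexes such that: (1) $\Delta_1$ is the boundary complex of a simplicial $d$-polytope, and for $j\ge2$, $\Delta_j$ is a $(d-1)$-ball which is a proper subcomplex of the boundary complex of a simplicial $d$-polytope; (2) for $j\ge2$, $\Delta_j\cap\bigcup_{i<j}\Delta_i=\partial\Delta_j$; (3) $\bigcup_j\Delta_j=\Delta$.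
   Formalization: The block containing an edge may also be the last block [n] minus the union of S_1,…,S_{r-1} (otherwise the faces are not closed under taking subfaces), and n ≥ 2 is assumed, since for n = 1 the complex has no faces at all. *)

theory Defs
  imports "HOL-Analysis.Analysis"
begin

text \<open>
  A finite simple graph has the finite type \<open>'v\<close> as its vertex set (so \<open>n = CARD('v)\<close>) and is
  given by its set of two-element edges.
\<close>

definition simple_graph :: "'v::finite set set \<Rightarrow> bool" where
  "simple_graph E \<longleftrightarrow> (\<forall>e\<in>E. card e = 2)"

definition vdegree :: "'v::finite set set \<Rightarrow> 'v \<Rightarrow> nat" where
  "vdegree E v = card {e \<in> E. v \<in> e}"

text \<open>
  A list \<open>S\<^sub>1|\<dots>|S\<^sub>r\<^sub>-\<^sub>1\<close> stands for the ordered set partition whose last block is the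
  nonempty complement \<open>S\<^sub>r\<close> of the union.  An edge may lie in any of the \<open>r\<close> blocks: without the
  block \<open>S\<^sub>r\<close> the faces would not be closed under coarsening (dropping the top element of the
  chain merges \<open>S\<^sub>r\<^sub>-\<^sub>1\<close> into \<open>S\<^sub>r\<close>).
\<close>

definition coloring_face :: "'v::finite set set \<Rightarrow> 'v set list \<Rightarrow> bool" where
  "coloring_face E Ss \<longleftrightarrow>
     (\<forall>S\<in>set Ss. S \<noteq> {}) \<and> sorted_wrt (\<lambda>A B. A \<inter> B = {}) Ss \<and> \<Union>(set Ss) \<noteq> UNIV \<and>
     (\<exists>S\<in>set (Ss @ [UNIV - \<Union>(set Ss)]). \<exists>e\<in>E. e \<subseteq> S)"

text \<open>
  The chain \<open>S\<^sub>1 \<subset> S\<^sub>1 \<union> S\<^sub>2 \<subset> \<dots>\<close>; inclusion of chains corresponds to refinement of lists.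
\<close>

definition list_chain :: "'v set list \<Rightarrow> 'v set set" where
  "list_chain Ss = (\<lambda>k. \<Union>(set (take k Ss))) ` {1..length Ss}"

definition coloring_complex :: "'v::finite set set \<Rightarrow> 'v set set set" where
  "coloring_complex E = list_chain ` {Ss. coloring_face E Ss}"

definition unipolar_complex :: "'v::finite set set \<Rightarrow> 'v \<Rightarrow> 'v set set set" where
  "unipolar_complex E v = list_chain ` {Ss. coloring_face E Ss \<and> v \<notin> \<Union>(set Ss)}"

text \<open>
  Abstract simplicial complexes, with the empty face.  (The library's \<open>simplicial_complex\<close> is the
  geometric notion.)
\<close>

definition abstract_complex :: "'a::finite set set \<Rightarrow> bool" where
  "abstract_complex K \<longleftrightarrow> {} \<in> K \<and> (\<forall>F\<in>K. \<forall>F'. F' \<subseteq> F \<longrightarrow> F' \<in> K)"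

definition complex_dim :: "'a::finite set set \<Rightarrow> int" where
  "complex_dim K = int (Max (card ` K)) - 1"

definition complex_facets :: "'a::finite set set \<Rightarrow> 'a set set" where
  "complex_facets K = {F \<in> K. \<forall>G\<in>K. F \<subseteq> G \<longrightarrow> G = F}"

definition pure_complex :: "int \<Rightarrow> 'a::finite set set \<Rightarrow> bool" where
  "pure_complex k K \<longleftrightarrow> abstract_complex K \<and> (\<forall>F\<in>complex_facets K. int (card F) - 1 = k)"

definition realization :: "'a::finite set set \<Rightarrow> (real ^ 'a) set" where
  "realization K = (\<Union>F\<in>K. convex hull ((\<lambda>x. axis x 1) ` F))"

text \<open>
  The closed unit ball of a \<open>k\<close>-dimensional subspace is the standard \<open>k\<close>-ball.  A complex of
  dimension \<open>k\<close> has at least \<open>k + 1\<close> vertices, so \<open>real ^ 'a\<close> contains such a subspace.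
\<close>

definition simplicial_ball :: "int \<Rightarrow> 'a::finite set set \<Rightarrow> bool" where
  "simplicial_ball k K \<longleftrightarrow> abstract_complex K \<and>
     (\<exists>T :: (real ^ 'a) set. subspace T \<and> int (dim T) = k \<and>
        realization K homeomorphic (cball 0 1 \<inter> T))"

text \<open>
  The boundary of a pure simplicial ball: the subcomplex generated by the codimension-one faces
  that lie in exactly one facet.  The boundary of a single point is the complex \<open>{{}}\<close>.
\<close>

definition ball_boundary :: "'a::finite set set \<Rightarrow> 'a set set" where
  "ball_boundary K = {F. \<exists>R\<in>K. F \<subseteq> R \<and>
     (\<exists>!G. G \<in> complex_facets K \<and> R \<subseteq> G \<and> card G = Suc (card R))}"

definition simplicial_polytope :: "int \<Rightarrow> 'e::euclidean_space set \<Rightarrow> bool" where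
  "simplicial_polytope d P \<longleftrightarrow> polytope P \<and> aff_dim P = d \<and>
     (\<forall>F. F face_of P \<and> F \<noteq> P \<longrightarrow> (\<exists>k. k simplex F))"

definition boundary_complex :: "'e::euclidean_space set \<Rightarrow> 'e set set" where
  "boundary_complex P = (\<lambda>F. {x. x extreme_point_of F}) ` {F. F face_of P \<and> F \<noteq> P}"

text \<open>
  Abstract complexes are compared with boundary complexes up to relabelling the vertices by an
  injection \<open>\<phi>\<close>.  Polytopes are taken in \<open>real ^ 'a\<close>, where \<open>'a\<close> is the type of vertices of the
  complex: if \<open>K\<close> has a face with \<open>d\<close> elements then \<open>d \<le> CARD('a)\<close>, so every \<open>d\<close>-polytope has
  an affine copy in this space, whatever its number of vertices.
\<close>

definition polytope_boundary :: "int \<Rightarrow> 'a::finite set set \<Rightarrow> bool" where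
  "polytope_boundary d K \<longleftrightarrow>
     (\<exists>(P :: (real ^ 'a) set) \<phi>. simplicial_polytope d P \<and> inj_on \<phi> (\<Union>K) \<and>
        (`) \<phi> ` K = boundary_complex P)"

definition proper_in_polytope_boundary :: "int \<Rightarrow> 'a::finite set set \<Rightarrow> bool" where
  "proper_in_polytope_boundary d K \<longleftrightarrow>
     (\<exists>(P :: (real ^ 'a) set) \<phi>. simplicial_polytope d P \<and> inj_on \<phi> (\<Union>K) \<and>
        (`) \<phi> ` K \<subset> boundary_complex P)"

text \<open>The subcomplexes are indexed from \<open>0\<close>.\<close>

definition convex_ear_decomposition :: "'a::finite set set \<Rightarrow> 'a set set list \<Rightarrow> bool" where
  "convex_ear_decomposition K Ks \<longleftrightarrow>
     (let d = complex_dim K + 1 in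
        abstract_complex K \<and> Ks \<noteq> [] \<and>
        (\<forall>j<length Ks. Ks ! j \<subseteq> K \<and> pure_complex (d - 1) (Ks ! j)) \<and>
        polytope_boundary d (Ks ! 0) \<and>
        (\<forall>j. 1 \<le> j \<and> j < length Ks \<longrightarrow>
           simplicial_ball (d - 1) (Ks ! j) \<and>
           proper_in_polytope_boundary d (Ks ! j) \<and>
           Ks ! j \<inter> (\<Union>i<j. Ks ! i) = ball_boundary (Ks ! j)) \<and>
        (\<Union>j<length Ks. Ks ! j) = K)"

end

theory Submission
  imports Defs
begin

text \<open>
  Let \<open>V\<close> be the vertex set without \<open>v\<close>. Since \<open>v\<close> is adjacent to everything, the unipolar
  complex consists of all chains of nonempty proper subsets of \<open>V\<close>, together with the cone with
  apex \<open>V\<close> over the coloring complex of \<open>G - v\<close>. The former is the Coxeter complex of type A, the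
  boundary of the simplicial polytope \<open>{x. \<Sum>\<bar>x\<^sub>i - x\<^sub>j\<bar> \<le> 1}\<close> in \<open>\<real>\<^sup>V\<close> modulo constants; it
  is the first subcomplex of the decomposition.

  The edges of \<open>G - v\<close> are then added one at a time. The hyperplane \<open>x\<^sub>a = x\<^sub>b\<close> of a new edge
  \<open>{a, b}\<close> is cut into regions by the hyperplanes of the edges \<open>F\<close> already added, and the ears are
  the cones over these regions. Such an ear is the complex of chains of nonempty order ideals of a
  preorder. It is a ball because a piecewise linear map takes it to the convex set of
  order-reversing functions of oscillation at most \<open>1\<close>. A face lies on the boundary of the ear
  precisely when the apex is missing or an edge of \<open>F\<close> lies in one block, that is, when it belongs
  to an earlier subcomplex. The substitution \<open>S \<mapsto> S \<union> {a}\<close>, \<open>V \<mapsto> {a}\<close> embeds the ear in the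
  star of the vertex \<open>{a}\<close> of the Coxeter complex itself, so no further polytopes are needed.
\<close>

section \<open>Chains of finite sets\<close>

lemma chain_subset_mono: "chain\<^sub>\<subseteq> C \<Longrightarrow> C' \<subseteq> C \<Longrightarrow> chain\<^sub>\<subseteq> C'"
  unfolding chain_subset_def by blast

lemma chain_Union_mem:
  fixes C :: "'v::finite set set"
  assumes "chain\<^sub>\<subseteq> C" "C \<noteq> {}"
  shows "\<Union>C \<in> C"
proof -
  have "finite C" by simp
  then show ?thesis
    using assms(2,1)
  proof (induction C rule: finite_ne_induct)
    case (insert T C)
    then have "\<Union>C \<in> C" using chain_subset_mono by blast
    then have "T \<subseteq> \<Union>C \<or> \<Union>C \<subseteq> T"
      using insert.prems unfolding chain_subset_def by blast
    then show ?case
      using \<open>\<Union>C \<in> C\<close> by (metis Union_insert insertCI sup.absorb1 sup.absorb2)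
  qed simp
qed

lemma chain_Inter_mem:
  fixes C :: "'v::finite set set"
  assumes "chain\<^sub>\<subseteq> C" "C \<noteq> {}"
  shows "\<Inter>C \<in> C"
proof -
  have "finite C" by simp
  then show ?thesis
    using assms(2,1)
  proof (induction C rule: finite_ne_induct)
    case (insert T C)
    then have "\<Inter>C \<in> C" using chain_subset_mono by blast
    then have "T \<subseteq> \<Inter>C \<or> \<Inter>C \<subseteq> T"
      using insert.prems unfolding chain_subset_def by blast
    then show ?case
      using \<open>\<Inter>C \<in> C\<close> by (metis Inter_insert insertCI inf.absorb1 inf.absorb2)
  qed simp
qed

text \<open>In a finite chain the strictly smaller members have a largest one, which leaves some
  \<open>i\<close> of \<open>S\<close> uncovered. Dually the strictly larger members share some
  \<open>j\<close> of \<open>V\<close> outside \<open>S\<close>. Only \<open>S\<close> itself then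
  tells \<open>i\<close> and \<open>j\<close> apart.\<close>

lemma chain_gap:
  fixes C :: "'v::finite set set"
  assumes "chain\<^sub>\<subseteq> C" "S \<in> C" "S \<noteq> {}" "S \<noteq> V" "C \<subseteq> Pow V"
  obtains i j where "i \<in> S" "j \<in> V - S" "\<And>T. T \<in> C \<Longrightarrow> T \<noteq> S \<Longrightarrow> i \<in> T \<longleftrightarrow> j \<in> T"
proof -
  let ?L = "{T \<in> C. T \<subset> S}" and ?U = "{T \<in> C. S \<subset> T}"
  have "\<Union>?L \<in> ?L" if "?L \<noteq> {}"
    using that by (intro chain_Union_mem chain_subset_mono[OF assms(1)]) auto
  then have "\<Union>?L \<subset> S" using assms(3) by blast
  then obtain i where i: "i \<in> S" "\<And>T. T \<in> C \<Longrightarrow> T \<subset> S \<Longrightarrow> i \<notin> T" by blast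
  have U: "\<Inter>?U \<in> ?U" if "?U \<noteq> {}"
    using that by (intro chain_Inter_mem chain_subset_mono[OF assms(1)]) auto
  have "S \<subset> V \<inter> \<Inter>?U"
  proof (cases "?U = {}")
    case True
    then show ?thesis using assms(2,4,5) by (simp only: True Inter_empty) auto
  next
    case False
    then have "\<Inter>?U \<in> ?U" by (rule U)
    then have "\<Inter>?U \<in> C" "S \<subset> \<Inter>?U" by simp_all
    moreover from this have "\<Inter>?U \<subseteq> V" using assms(5) by (metis PowD subsetD)
    ultimately show ?thesis by (simp add: Int_absorb1)
  qed
  then obtain j where "j \<in> V \<inter> \<Inter>?U" "j \<notin> S" by (meson psubsetE subsetI)
  then have j: "j \<in> V - S" "\<And>T. T \<in> C \<Longrightarrow> S \<subset> T \<Longrightarrow> j \<in> T" by auto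
  have "i \<in> T \<longleftrightarrow> j \<in> T" if "T \<in> C" "T \<noteq> S" for T
  proof -
    have "T \<subset> S \<or> S \<subset> T" using assms(1,2) that unfolding chain_subset_def by blast
    then show ?thesis using i j that by blast
  qed
  then show ?thesis using that i j by blast
qed

text \<open>For \<open>i\<close> in \<open>S\<close>, the least member containing \<open>i\<close>
  stays inside \<open>S\<close>, since every \<open>j\<close> outside is excluded by some member.
  These members cover \<open>S\<close>, and the union of the members inside \<open>S\<close> is
  again a member.\<close>

lemma chain_mem_if_separates:
  fixes C :: "'v::finite set set"
  assumes "chain\<^sub>\<subseteq> C" "S \<noteq> {}" "S \<subset> V"
    and sep: "\<And>i j. i \<in> S \<Longrightarrow> j \<in> V - S \<Longrightarrow> \<exists>T\<in>C. i \<in> T \<and> j \<notin> T"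
    and "C \<subseteq> Pow V"
  shows "S \<in> C"
proof -
  have below: "\<exists>T\<in>C. i \<in> T \<and> T \<subseteq> S" if "i \<in> S" for i
  proof
    let ?L = "{T \<in> C. i \<in> T}"
    have "?L \<noteq> {}" using sep[OF that] assms(3) by blast
    then have "\<Inter>?L \<in> ?L"
      by (intro chain_Inter_mem chain_subset_mono[OF assms(1)]) auto
    then show "\<Inter>?L \<in> C" by blast
    show "i \<in> \<Inter>?L \<and> \<Inter>?L \<subseteq> S"
    proof (intro conjI subsetI)
      fix j assume j: "j \<in> \<Inter>?L"
      then have "j \<in> V" using \<open>?L \<noteq> {}\<close> assms(5) by blast
      then show "j \<in> S" using sep[OF that, of j] j by blast
    qed blast
  qed
  let ?L = "{T \<in> C. T \<subseteq> S}"
  have "\<Union>?L = S" using below by blast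
  moreover have "\<Union>?L \<in> ?L"
    using below assms(2) by (intro chain_Union_mem chain_subset_mono[OF assms(1)]) auto
  ultimately show ?thesis by auto
qed

section \<open>Functions modulo constants as positive combinations of indicators along a
  chain\<close>

abbreviation chain_diff :: "'v set set \<Rightarrow> ('v set \<Rightarrow> real) \<Rightarrow> 'v \<Rightarrow> 'v \<Rightarrow> real" where
  "chain_diff C y i j \<equiv> (\<Sum>T\<in>C. y T * (of_bool (i \<in> T) - of_bool (j \<in> T)))"

text \<open>A member containing \<open>j\<close> but not \<open>i\<close> would be incomparable with
  \<open>S\<close>. Hence every summand is nonnegative, and the one of \<open>S\<close> is
  \<open>y S\<close>.\<close>

lemma chain_coeff_le_diff:
  fixes C :: "'v::finite set set"
  assumes "chain\<^sub>\<subseteq> C" "S \<in> C" "\<And>T. T \<in> C \<Longrightarrow> 0 \<le> y T" "i \<in> S" "j \<notin> S"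
  shows "y S \<le> chain_diff C y i j"
proof -
  have "y S * (of_bool (i \<in> S) - of_bool (j \<in> S)) \<le> chain_diff C y i j"
  proof (rule member_le_sum)
    fix T assume T: "T \<in> C - {S}"
    then have "j \<in> T \<Longrightarrow> i \<in> T"
      using assms unfolding chain_subset_def by blast
    then show "0 \<le> y T * (of_bool (i \<in> T) - of_bool (j \<in> T))"
      using assms(3) T by auto
  qed (use assms in auto)
  then show ?thesis using assms by simp
qed

lemma chain_coeff_eq_diff:
  fixes C :: "'v::finite set set"
  assumes "chain\<^sub>\<subseteq> C" "S \<in> C" "S \<noteq> {}" "S \<noteq> V" "C \<subseteq> Pow V"
  obtains i j where "i \<in> S" "j \<in> V - S" "chain_diff C y i j = y S"
proof -
  obtain i j where ij: "i \<in> S" "j \<in> V - S" "\<And>T. T \<in> C \<Longrightarrow> T \<noteq> S \<Longrightarrow> i \<in> T \<longleftrightarrow> j \<in> T"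
    using chain_gap[OF assms] by blast
  have "chain_diff C y i j = y S"
  proof -
    have "chain_diff C y i j = (\<Sum>T\<in>C. if T = S then y S else 0)"
      using ij by (intro sum.cong) auto
    then show ?thesis using assms by simp
  qed
  then show ?thesis using that ij by blast
qed

text \<open>A set missing from the chain has a pair that no member separates in its direction; all
  summands are nonpositive there.\<close>

lemma chain_diff_nonpos:
  fixes C :: "'v::finite set set"
  assumes "chain\<^sub>\<subseteq> C" "S \<notin> C" "S \<noteq> {}" "S \<subset> V" "C \<subseteq> Pow V" "\<And>T. T \<in> C \<Longrightarrow> 0 \<le> y T"
  obtains i j where "i \<in> S" "j \<in> V - S" "chain_diff C y i j \<le> 0"
proof -
  obtain i j where ij: "i \<in> S" "j \<in> V - S" "\<not> (\<exists>T\<in>C. i \<in> T \<and> j \<notin> T)"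
    using chain_mem_if_separates[of C S V] assms by blast
  have "chain_diff C y i j \<le> 0"
    using ij assms(6) by (intro sum_nonpos) (auto simp: mult_nonneg_nonpos)
  then show ?thesis using that ij by blast
qed

text \<open>The coefficient of a member \<open>S\<close> is the least difference over pairs that
  \<open>S\<close> cuts, and a set that is not a member cuts a pair with nonpositive difference.
  Both the chain and its coefficients can thus be read off from the differences.\<close>

lemma chain_representation_unique:
  fixes C C' :: "'v::finite set set"
  assumes C: "chain\<^sub>\<subseteq> C" "C \<subseteq> Pow V - {{}, V}" "\<And>T. T \<in> C \<Longrightarrow> 0 < y T"
    and C': "chain\<^sub>\<subseteq> C'" "C' \<subseteq> Pow V - {{}, V}" "\<And>T. T \<in> C' \<Longrightarrow> 0 < y' T"
    and eq: "\<And>i j. i \<in> V \<Longrightarrow> j \<in> V \<Longrightarrow> chain_diff C y i j = chain_diff C' y' i j"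
  shows "C = C'" "\<And>S. S \<in> C \<Longrightarrow> y S = y' S"
proof -
  have sub: "D \<subseteq> D'"
    if D: "chain\<^sub>\<subseteq> D" "D \<subseteq> Pow V - {{}, V}" "\<And>T. T \<in> D \<Longrightarrow> 0 < z T"
      and D': "chain\<^sub>\<subseteq> D'" "D' \<subseteq> Pow V - {{}, V}" "\<And>T. T \<in> D' \<Longrightarrow> 0 < z' T"
      and eq: "\<And>i j. i \<in> V \<Longrightarrow> j \<in> V \<Longrightarrow> chain_diff D z i j = chain_diff D' z' i j"
    for D D' :: "'v set set" and z z'
  proof (rule subsetI, rule ccontr)
    fix S assume S: "S \<in> D" "S \<notin> D'"
    have "S \<noteq> {}" "S \<subset> V" "D' \<subseteq> Pow V" using S D(2) D'(2) by auto
    then obtain i j where ij: "i \<in> S" "j \<in> V - S" "chain_diff D' z' i j \<le> 0"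
      by (rule chain_diff_nonpos[OF D'(1) S(2) _ _ _ less_imp_le[OF D'(3)]])
    then have "z S \<le> chain_diff D z i j"
      using chain_coeff_le_diff[of D S z i j] D S by (auto simp: less_imp_le)
    moreover have "i \<in> V" using ij S D by blast
    ultimately show False using eq[of i j] ij D(3)[OF S(1)] by auto
  qed
  show CC': "C = C'"
    using sub[OF C C' eq] sub[OF C' C eq[symmetric]] by blast
  have le: "z' S \<le> z S"
    if S: "S \<in> C" and z': "\<And>T. T \<in> C \<Longrightarrow> 0 < z' T"
      and eq: "\<And>i j. i \<in> V \<Longrightarrow> j \<in> V \<Longrightarrow> chain_diff C z i j = chain_diff C z' i j" for S z z'
  proof -
    have "S \<noteq> {}" "S \<noteq> V" "C \<subseteq> Pow V" using S C(2) by auto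
    from chain_coeff_eq_diff[OF C(1) S this, of z]
    obtain i j where ij: "i \<in> S" "j \<in> V - S" "chain_diff C z i j = z S" by blast
    then have "z' S \<le> chain_diff C z' i j"
      using chain_coeff_le_diff[of C S z' i j] C(1) S z' by (auto simp: less_imp_le)
    moreover have "i \<in> V" using ij S C by blast
    ultimately show ?thesis using eq[of i j] ij(2,3) by auto
  qed
  show "y S = y' S" if "S \<in> C" for S
  proof (rule order_antisym)
    show "y S \<le> y' S"
      by (rule le[OF that C(3)]) (use eq[folded CC'] in simp_all)
    show "y' S \<le> y S"
      by (rule le[OF that C'(3)[folded CC']]) (use eq[folded CC'] in simp_all)
  qed
qed

text \<open>Peel off the top level set: capping \<open>x\<close> at its second largest value
  \<open>M'\<close> removes one value, and the set \<open>S\<close> where the maximum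
  \<open>M\<close> is attained receives the coefficient \<open>M - M'\<close>.\<close>

lemma chain_representation_exists:
  fixes x :: "'v::finite \<Rightarrow> real" and V :: "'v set"
  shows "\<exists>C y c. chain\<^sub>\<subseteq> C \<and> C \<subseteq> Pow V - {{}, V} \<and> (\<forall>T\<in>C. 0 < y T) \<and>
    (\<forall>i\<in>V. x i = c + (\<Sum>T\<in>C. y T * of_bool (i \<in> T)))"
proof (induction "card (x ` V)" arbitrary: x rule: less_induct)
  case (less x)
  show ?case
  proof (cases "\<exists>i\<in>V. \<exists>j\<in>V. x i \<noteq> x j")
    case False
    then obtain c where "\<forall>i\<in>V. x i = c" by meson
    then show ?thesis by (intro exI[of _ "{}"]) (auto simp: chain_subset_def)
  next
    case True
    define M where "M = Max (x ` V)"
    define M' where "M' = Max (x ` V - {M})"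
    define S where "S = {i \<in> V. x i = M}"
    define x' where "x' i = min (x i) M'" for i
    have V: "V \<noteq> {}" using True by blast
    then have M: "M \<in> x ` V" unfolding M_def by (intro Max_in) auto
    have leM: "x i \<le> M" if "i \<in> V" for i using that unfolding M_def by auto
    have "x ` V - {M} \<noteq> {}" using True by auto
    then have M': "M' \<in> x ` V - {M}" unfolding M'_def by (intro Max_in) auto
    have leM': "x i \<le> M'" if "i \<in> V" "i \<notin> S" for i
      using that unfolding M'_def S_def by (intro Max_ge) auto
    have "M' < M" using M' leM by force
    have x'_S: "x' i = M'" if "i \<in> S" for i
      using that \<open>M' < M\<close> by (auto simp: S_def x'_def)
    have x'_V: "x' i = x i" if "i \<in> V" "i \<notin> S" for i
      using leM'[OF that] by (simp add: x'_def)
    have "x' ` V \<subseteq> x ` V - {M}"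
    proof
      fix t assume "t \<in> x' ` V"
      then obtain i where "i \<in> V" "t = x' i" by blast
      then show "t \<in> x ` V - {M}" using x'_S x'_V M' by (cases "i \<in> S") (auto simp: S_def)
    qed
    then have "card (x' ` V) < card (x ` V)"
      using M by (intro psubset_card_mono) auto
    from less[OF this] obtain C y c where C: "chain\<^sub>\<subseteq> C" "C \<subseteq> Pow V - {{}, V}"
      and y: "\<And>T. T \<in> C \<Longrightarrow> 0 < y T"
      and rep: "\<And>i. i \<in> V \<Longrightarrow> x' i = c + (\<Sum>T\<in>C. y T * of_bool (i \<in> T))" by blast
    \<comment> \<open>The positive coefficient of \<open>T\<close> makes it closed under passing to
      larger values of \<open>x'\<close>. So it contains the whole level \<open>M'\<close>, the
      maximum of \<open>x'\<close>, which comprises \<open>S\<close> and at least one point outside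
      \<open>S\<close>.\<close>
    have S_sub: "S \<subset> T" if T: "T \<in> C" for T
    proof -
      have up: "j \<in> T" if "i \<in> T" "j \<in> V" "x' i \<le> x' j" for i j
      proof (rule ccontr)
        assume "j \<notin> T"
        then have "y T \<le> chain_diff C y i j"
          using chain_coeff_le_diff[OF C(1) T, of y i j] y that by (auto simp: less_imp_le)
        moreover have "i \<in> V" using that T C by blast
        then have "chain_diff C y i j = x' i - x' j"
          using rep[of i] rep[of j] that by (simp add: sum_subtractf algebra_simps)
        ultimately show False using y[OF T] that by auto
      qed
      obtain i where i: "i \<in> T" using T C by auto
      have "x' i \<le> M'" by (simp add: x'_def)
      then have "j \<in> T" if "j \<in> V" "x' j = M'" for j using up[OF i] that by simp
      moreover obtain k where "k \<in> V" "x k = M'" using M' by auto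
      ultimately have "k \<in> T - S" "S \<subseteq> T"
        using x'_S \<open>M' < M\<close> by (auto simp: S_def x'_def)
      then show ?thesis by blast
    qed
    have SC: "S \<notin> C" using S_sub by blast
    define z where "z = y(S := M - M')"
    have "x i = c + (\<Sum>T\<in>insert S C. z T * of_bool (i \<in> T))" if "i \<in> V" for i
    proof -
      have "(\<Sum>T\<in>insert S C. z T * of_bool (i \<in> T)) =
          (M - M') * of_bool (i \<in> S) + (\<Sum>T\<in>C. z T * of_bool (i \<in> T))"
        using SC by (simp add: z_def)
      also have "(\<Sum>T\<in>C. z T * of_bool (i \<in> T)) = (\<Sum>T\<in>C. y T * of_bool (i \<in> T))"
        using SC by (intro sum.cong) (auto simp: z_def)
      finally show ?thesis
        using rep[OF that] x'_S[of i] x'_V[of i] that by (cases "i \<in> S") (auto simp: S_def)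
    qed
    moreover have "chain\<^sub>\<subseteq> (insert S C)"
      using C(1) S_sub unfolding chain_subset_def by blast
    moreover have "S \<subseteq> V" "S \<noteq> {}" "S \<noteq> V" using M M' by (auto simp: S_def)
    moreover have "\<forall>T\<in>insert S C. 0 < z T" using y \<open>M' < M\<close> by (auto simp: z_def)
    ultimately show ?thesis
      using C(2) by (intro exI[of _ "insert S C"] exI[of _ z] exI[of _ c]) auto
  qed
qed

section \<open>The polytope of the Coxeter complex\<close>

text \<open>
  The indicator of \<open>S\<close> modulo constants, normalised to vanish at \<open>w\<close>; the coordinate of
  \<open>i \<in> V\<close> is the one indexed by \<open>{i}\<close>.
\<close>

definition cut_vec :: "'v::finite set \<Rightarrow> 'v \<Rightarrow> 'v set \<Rightarrow> real ^ ('v set)" where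
  "cut_vec V w S =
     (\<chi> X. if X \<in> (\<lambda>i. {i}) ` V then of_bool (X \<subseteq> S) - of_bool (w \<in> S) else 0)"

text \<open>Polytopes have to live in \<open>real ^ 'a\<close> with \<open>'a\<close> the vertex
  type of the complex, here \<open>'v set\<close>. Functions on \<open>I\<close> are therefore
  stored on the singleton coordinates.\<close>

definition coord_space :: "'v::finite set \<Rightarrow> (real ^ ('v set)) set" where
  "coord_space I = {x. \<forall>X. X \<notin> (\<lambda>i. {i}) ` I \<longrightarrow> x $ X = 0}"

lemma cut_vec_nth: "i \<in> V \<Longrightarrow> cut_vec V w S $ {i} = of_bool (i \<in> S) - of_bool (w \<in> S)"
  by (simp add: cut_vec_def)

text \<open>The constant function is zero modulo constants, so the apex \<open>V\<close> of the
  cones is sent to the origin.\<close>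

lemma cut_vec_whole: "w \<in> V \<Longrightarrow> cut_vec V w V = 0"
  by (auto simp: cut_vec_def vec_eq_iff)

lemma cut_vec_compl: "w \<in> V \<Longrightarrow> cut_vec V w (V - S) = - cut_vec V w S"
  by (auto simp: cut_vec_def vec_eq_iff)

lemma subspace_coord_space: "subspace (coord_space I)"
  by (auto simp: subspace_def coord_space_def)

lemma dim_coord_space: "dim (coord_space I) = card I"
proof -
  have "dim (coord_space I) = card ((\<lambda>i. {i}) ` I)"
    using dim_substandard_cart[where 'a=real, of "(\<lambda>i. {i}) ` I"]
    by (simp add: coord_space_def dim_vec_eq)
  then show ?thesis by (simp add: card_image)
qed

lemma coord_space_eqI:
  assumes "x \<in> coord_space I" "y \<in> coord_space I" "\<And>i. i \<in> I \<Longrightarrow> x $ {i} = y $ {i}"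
  shows "x = y"
  unfolding vec_eq_iff
proof
  fix X show "x $ X = y $ X"
    using assms by (cases "X \<in> (\<lambda>i. {i}) ` I") (auto simp: coord_space_def)
qed

lemma cut_vec_in_coord_space: "cut_vec V w S \<in> coord_space (V - {w})"
  unfolding coord_space_def
proof (intro CollectI allI impI)
  fix X assume "X \<notin> (\<lambda>i. {i}) ` (V - {w})"
  then have "X \<notin> (\<lambda>i. {i}) ` V \<or> X = {w}" by auto
  then show "cut_vec V w S $ X = 0" by (auto simp: cut_vec_def)
qed

lemma cut_vec_sum_diff:
  assumes "i \<in> V" "j \<in> V"
  shows "(\<Sum>T\<in>C. y T *\<^sub>R cut_vec V w T) $ {i} - (\<Sum>T\<in>C. y T *\<^sub>R cut_vec V w T) $ {j}
    = chain_diff C y i j"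
  using assms
  by (simp add: cut_vec_nth sum_subtractf[symmetric] right_diff_distrib[symmetric])

text \<open>The cones spanned by chains cover the space. The additive constant of the chain
  representation disappears because both sides vanish at \<open>w\<close>.\<close>

lemma cut_vec_representation:
  fixes x :: "real ^ ('v::finite set)"
  assumes "x \<in> coord_space (V - {w})" "w \<in> V"
  shows "\<exists>C y. chain\<^sub>\<subseteq> C \<and> C \<subseteq> Pow V - {{}, V} \<and> (\<forall>T\<in>C. 0 < y T) \<and>
    x = (\<Sum>T\<in>C. y T *\<^sub>R cut_vec V w T)"
proof -
  obtain C y c where C: "chain\<^sub>\<subseteq> C" "C \<subseteq> Pow V - {{}, V}" "\<forall>T\<in>C. 0 < y T"
    and rep: "\<forall>i\<in>V. x $ {i} = c + (\<Sum>T\<in>C. y T * of_bool (i \<in> T))"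
    using chain_representation_exists[of V "\<lambda>i. x $ {i}"] by blast
  have w: "x $ {w} = 0" using assms by (auto simp: coord_space_def)
  have "x = (\<Sum>T\<in>C. y T *\<^sub>R cut_vec V w T)" (is "_ = ?y")
  proof (rule coord_space_eqI[OF assms(1)])
    show y: "?y \<in> coord_space (V - {w})"
      by (intro subspace_sum subspace_scale subspace_coord_space cut_vec_in_coord_space)
    fix i assume i: "i \<in> V - {w}"
    have "?y $ {i} - ?y $ {w} = chain_diff C y i w"
      using i assms by (intro cut_vec_sum_diff) auto
    moreover have "?y $ {w} = 0" using y by (auto simp: coord_space_def)
    moreover have "x $ {i} - x $ {w} = chain_diff C y i w"
      using rep i assms by (simp add: sum_subtractf algebra_simps)
    ultimately show "x $ {i} = ?y $ {i}" using w by simp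
  qed
  then show ?thesis using C by blast
qed

lemma cut_vec_coeff_zero:
  fixes C :: "'v::finite set set"
  assumes "chain\<^sub>\<subseteq> C" "C \<subseteq> Pow V - {{}, V}" "(\<Sum>T\<in>C. y T *\<^sub>R cut_vec V w T) = 0" "S \<in> C"
  shows "y S = 0"
proof -
  have "S \<noteq> {}" "S \<noteq> V" "C \<subseteq> Pow V" using assms by auto
  then obtain i j where ij: "i \<in> S" "j \<in> V - S" "chain_diff C y i j = y S"
    by (rule chain_coeff_eq_diff[OF assms(1,4)])
  moreover have "i \<in> V" using ij assms by blast
  ultimately show ?thesis using cut_vec_sum_diff[of i V j y w C] assms by simp
qed

text \<open>\<open>chain_gap\<close> supplies a pair of coordinates whose difference isolates one
  coefficient. The scaling allows both the normalised polytope vertices and the plain vectors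
  \<open>cut_vec\<close>.\<close>

lemma independent_scaled_cut_vec:
  fixes C :: "'v::finite set set"
  assumes "chain\<^sub>\<subseteq> C" "C \<subseteq> Pow V - {{}, V}" "\<And>T. T \<in> C \<Longrightarrow> c T \<noteq> 0"
  shows "inj_on (\<lambda>T. c T *\<^sub>R cut_vec V w T) C"
    and "independent ((\<lambda>T. c T *\<^sub>R cut_vec V w T) ` C)"
proof -
  let ?u = "\<lambda>T. c T *\<^sub>R cut_vec V w T"
  have zero: "y S = 0" if "(\<Sum>T\<in>C. y T *\<^sub>R ?u T) = 0" "S \<in> C" for y S
  proof -
    have "(\<Sum>T\<in>C. (y T * c T) *\<^sub>R cut_vec V w T) = 0" using that(1) by simp
    then show ?thesis using cut_vec_coeff_zero[OF assms(1,2) _ that(2)] assms(3) that(2)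
      by fastforce
  qed
  show inj: "inj_on ?u C"
  proof (rule inj_onI, rule ccontr)
    fix S T assume ST: "S \<in> C" "T \<in> C" "?u S = ?u T" "S \<noteq> T"
    let ?y = "\<lambda>R. if R = S then 1 else if R = T then - 1 else 0"
    have "(\<Sum>R\<in>C. ?y R *\<^sub>R ?u R) = (\<Sum>R\<in>{S, T}. ?y R *\<^sub>R ?u R)"
      using ST by (intro sum.mono_neutral_right) auto
    also have "\<dots> = 0" using ST by simp
    finally have "(\<Sum>R\<in>C. ?y R *\<^sub>R ?u R) = 0" .
    from zero[OF this ST(1)] show False using ST by simp
  qed
  show "independent (?u ` C)"
  proof (rule independent_if_scalars_zero)
    fix f x assume f: "(\<Sum>x\<in>?u ` C. f x *\<^sub>R x) = 0" and x: "x \<in> ?u ` C"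
    have "(\<Sum>T\<in>C. f (?u T) *\<^sub>R ?u T) = 0"
      using f by (simp only: sum.reindex[OF inj] o_def)
    then have "f (?u T) = 0" if "T \<in> C" for T by (rule zero[OF _ that])
    then show "f x = 0" using x by blast
  qed simp
qed

text \<open>
  The functional supporting the face of a chain \<open>C\<close>: it sums \<open>x\<^sub>i - x\<^sub>j\<close> over the pairs that \<open>C\<close>
  separates, so it is at most \<open>\<Sum>\<bar>x\<^sub>i - x\<^sub>j\<bar>\<close> (over unordered pairs), with equality exactly on
  the cone over \<open>C\<close>.
\<close>

definition sep_vec :: "'v::finite set \<Rightarrow> 'v set set \<Rightarrow> real ^ ('v set)" where
  "sep_vec V C = (\<Sum>p\<in>V \<times> V. of_bool (\<exists>T\<in>C. fst p \<in> T \<and> snd p \<notin> T) *\<^sub>R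
     (axis {fst p} 1 - axis {snd p} 1))"

text \<open>The value at the indicator of \<open>S\<close> of the sum of \<open>|x_i - x_j|\<close>
  over unordered pairs from \<open>V\<close>.\<close>

definition cut_size :: "'v::finite set \<Rightarrow> 'v set \<Rightarrow> real" where
  "cut_size V S = real (card (S \<times> (V - S)))"

lemma cut_size_pos: "S \<in> Pow V - {{}, V} \<Longrightarrow> 0 < cut_size V S"
proof -
  assume "S \<in> Pow V - {{}, V}"
  then have "S \<noteq> {}" "V - S \<noteq> {}" by auto
  then show ?thesis by (simp add: cut_size_def card_gt_0_iff)
qed

lemma sep_vec_cut_vec:
  "sep_vec V C \<bullet> cut_vec V w S = (\<Sum>p\<in>V \<times> V. of_bool (\<exists>T\<in>C. fst p \<in> T \<and> snd p \<notin> T) *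
     (of_bool (fst p \<in> S) - of_bool (snd p \<in> S)))"
  unfolding sep_vec_def inner_sum_left
  by (intro sum.cong refl) (auto simp: inner_diff_left inner_axis' cut_vec_nth)

lemma cut_size_eq_sum:
  "S \<subseteq> V \<Longrightarrow> cut_size V S = (\<Sum>p\<in>V \<times> V. of_bool (p \<in> S \<times> (V - S)))"
proof -
  assume "S \<subseteq> V"
  then have "V \<times> V \<inter> S \<times> (V - S) = S \<times> (V - S)" by blast
  then show ?thesis by (simp add: cut_size_def of_bool_def sum.If_cases)
qed

text \<open>If \<open>S\<close> belongs to the chain, every pair that \<open>S\<close> cuts is
  separated by the chain, and no pair is separated in the opposite direction. The two sums agree
  term by term.\<close>

lemma sep_vec_mem:
  assumes "chain\<^sub>\<subseteq> C" "S \<in> C" "S \<subseteq> V"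
  shows "sep_vec V C \<bullet> cut_vec V w S = cut_size V S"
  unfolding sep_vec_cut_vec cut_size_eq_sum[OF assms(3)]
proof (intro sum.cong refl)
  fix p assume "p \<in> V \<times> V"
  then obtain i j where "p = (i, j)" "i \<in> V" "j \<in> V" by blast
  moreover have "\<not> (\<exists>T\<in>C. i \<in> T \<and> j \<notin> T)" if "i \<notin> S" "j \<in> S"
    using assms that unfolding chain_subset_def by blast
  ultimately show "of_bool (\<exists>T\<in>C. fst p \<in> T \<and> snd p \<notin> T) *
      (of_bool (fst p \<in> S) - of_bool (snd p \<in> S)) = (of_bool (p \<in> S \<times> (V - S)) :: real)"
    using assms(2) by (cases "i \<in> S"; cases "j \<in> S") auto
qed

text \<open>The terms compare one by one, and strictly at a pair cut by \<open>S\<close> that no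
  member of the chain separates.\<close>

lemma sep_vec_not_mem:
  assumes "chain\<^sub>\<subseteq> C" "S \<notin> C" "S \<in> Pow V - {{}, V}" "C \<subseteq> Pow V"
  shows "sep_vec V C \<bullet> cut_vec V w S < cut_size V S"
proof -
  have S: "S \<subseteq> V" "S \<noteq> {}" "S \<subset> V" using assms by auto
  show ?thesis
    unfolding sep_vec_cut_vec cut_size_eq_sum[OF S(1)]
  proof (rule sum_strict_mono_ex1)
    obtain i j where ij: "i \<in> S" "j \<in> V - S" "\<not> (\<exists>T\<in>C. i \<in> T \<and> j \<notin> T)"
      using chain_mem_if_separates[OF assms(1) S(2,3) _ assms(4)] assms(2) by blast
    then show "\<exists>p\<in>V \<times> V. of_bool (\<exists>T\<in>C. fst p \<in> T \<and> snd p \<notin> T) *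
      (of_bool (fst p \<in> S) - of_bool (snd p \<in> S)) < (of_bool (p \<in> S \<times> (V - S)) :: real)"
      using S(1) by (intro bexI[of _ "(i, j)"]) auto
  qed auto
qed

section \<open>The polytope, its faces and its dimension\<close>

definition coxeter_vertex :: "'v::finite set \<Rightarrow> 'v \<Rightarrow> 'v set \<Rightarrow> real ^ ('v set)" where
  "coxeter_vertex V w S = inverse (cut_size V S) *\<^sub>R cut_vec V w S"

text \<open>The origin is listed so that \<open>V = {w}\<close> gives a point, the polytope of
  dimension 0. With more elements it is already the midpoint of the vertices of complementary
  sets.\<close>

definition coxeter_polytope :: "'v::finite set \<Rightarrow> 'v \<Rightarrow> (real ^ ('v set)) set" where
  "coxeter_polytope V w = convex hull insert 0 (coxeter_vertex V w ` (Pow V - {{}, V}))"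

definition proper_chains :: "'v set \<Rightarrow> 'v set set set" where
  "proper_chains V = {C. chain\<^sub>\<subseteq> C \<and> C \<subseteq> Pow V - {{}, V}}"

lemma sep_vec_vertex_le:
  assumes "C \<in> proper_chains V" "S \<in> Pow V - {{}, V}"
  shows "sep_vec V C \<bullet> coxeter_vertex V w S \<le> 1"
    and "sep_vec V C \<bullet> coxeter_vertex V w S = 1 \<longleftrightarrow> S \<in> C"
proof -
  have pos: "0 < cut_size V S" using assms cut_size_pos by blast
  have C: "chain\<^sub>\<subseteq> C" "C \<subseteq> Pow V" using assms by (auto simp: proper_chains_def)
  have "S \<in> C \<Longrightarrow> sep_vec V C \<bullet> coxeter_vertex V w S = 1"
    using sep_vec_mem[of C S V w] C pos assms(2) by (auto simp: coxeter_vertex_def)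
  moreover have "S \<notin> C \<Longrightarrow> sep_vec V C \<bullet> coxeter_vertex V w S < 1"
    using sep_vec_not_mem[OF C(1) _ assms(2) C(2), of w] pos
    by (auto simp: coxeter_vertex_def field_simps)
  ultimately show "sep_vec V C \<bullet> coxeter_vertex V w S \<le> 1"
    "sep_vec V C \<bullet> coxeter_vertex V w S = 1 \<longleftrightarrow> S \<in> C" by force+
qed

lemma sep_vec_le_polytope:
  assumes "C \<in> proper_chains V" "x \<in> coxeter_polytope V w"
  shows "sep_vec V C \<bullet> x \<le> 1"
proof -
  have "coxeter_polytope V w \<subseteq> {x. sep_vec V C \<bullet> x \<le> 1}"
    unfolding coxeter_polytope_def
    by (intro hull_minimal convex_halfspace_le) (use sep_vec_vertex_le(1)[OF assms(1)] in auto)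
  then show ?thesis using assms by blast
qed

text \<open>The supporting functional of the one-member chain \<open>{S}\<close> attains 1 at the
  vertex of \<open>S\<close> and at no other.\<close>

lemma inj_on_coxeter_vertex: "inj_on (coxeter_vertex V w) (Pow V - {{}, V})"
proof (rule inj_onI)
  fix S T assume *: "S \<in> Pow V - {{}, V}" "T \<in> Pow V - {{}, V}"
    "coxeter_vertex V w S = coxeter_vertex V w T"
  have "{S} \<in> proper_chains V" using * by (auto simp: proper_chains_def chain_subset_def)
  then show "S = T" using sep_vec_vertex_le(2)[of "{S}" V _ w] * by (metis singleton_iff)
qed

lemma coxeter_vertex_independent:
  assumes "C \<in> proper_chains V"
  shows "\<not> affine_dependent (coxeter_vertex V w ` C)"
proof -
  have C: "chain\<^sub>\<subseteq> C" "C \<subseteq> Pow V - {{}, V}" using assms by (auto simp: proper_chains_def)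
  moreover have "inverse (cut_size V T) \<noteq> 0" if "T \<in> C" for T
    using cut_size_pos[of T V] subsetD[OF C(2) that] by simp
  ultimately have "independent (coxeter_vertex V w ` C)"
    unfolding coxeter_vertex_def by (rule independent_scaled_cut_vec(2))
  then show ?thesis using affine_dependent_imp_dependent by blast
qed

text \<open>The functional \<open>sep_vec V C\<close> is 1 on the affine hull of the vertices from
  \<open>C\<close> and below 1 on the convex hull of all other generators, so these two sets are
  disjoint. The face is proper because the functional vanishes at the origin.\<close>

lemma coxeter_face:
  assumes "C \<in> proper_chains V"
  shows "convex hull (coxeter_vertex V w ` C) face_of coxeter_polytope V w"
    and "convex hull (coxeter_vertex V w ` C) \<noteq> coxeter_polytope V w"
proof -
  let ?u = "coxeter_vertex V w" and ?a = "sep_vec V C"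
  have C: "C \<subseteq> Pow V - {{}, V}" using assms by (auto simp: proper_chains_def)
  have hull: "affine hull (?u ` C) \<subseteq> {x. ?a \<bullet> x = 1}"
    using sep_vec_vertex_le(2)[OF assms subsetD[OF C]]
    by (intro hull_minimal affine_hyperplane) auto
  have "convex hull (insert 0 (?u ` (Pow V - {{}, V})) - ?u ` C) \<subseteq> {x. ?a \<bullet> x < 1}"
  proof (intro hull_minimal convex_halfspace_lt subsetI)
    fix x assume x: "x \<in> insert 0 (?u ` (Pow V - {{}, V})) - ?u ` C"
    show "x \<in> {x. ?a \<bullet> x < 1}"
    proof (cases "x = 0")
      case False
      then obtain S where S: "S \<in> Pow V - {{}, V}" "x = ?u S" "S \<notin> C" using x by blast
      then show ?thesis using sep_vec_vertex_le[OF assms S(1), of w] by auto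
    qed simp
  qed
  then have "affine hull (?u ` C) \<inter>
      convex hull (insert 0 (?u ` (Pow V - {{}, V})) - ?u ` C) = {}"
    using hull by fastforce
  then show "convex hull (?u ` C) face_of coxeter_polytope V w"
    unfolding coxeter_polytope_def using C by (intro face_of_convex_hulls) auto
  have "0 \<notin> convex hull (?u ` C)"
    using hull convex_hull_subset_affine_hull[of "?u ` C"] by auto
  then show "convex hull (?u ` C) \<noteq> coxeter_polytope V w"
    unfolding coxeter_polytope_def by (metis hull_inc insertI1)
qed

lemma coxeter_polytope_subset:
  "coxeter_polytope V w \<subseteq> coord_space (V - {w})"
  unfolding coxeter_polytope_def coxeter_vertex_def
  by (intro hull_minimal subspace_imp_convex subspace_coord_space)
    (auto intro!: subspace_scale subspace_0 subspace_coord_space cut_vec_in_coord_space)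

lemma coxeter_vertex_compl:
  assumes "w \<in> V" "S \<subseteq> V"
  shows "coxeter_vertex V w (V - S) = - coxeter_vertex V w S"
proof -
  have "V - (V - S) = S" using assms by blast
  then have "cut_size V (V - S) = cut_size V S"
    by (simp add: cut_size_def card_cartesian_product mult.commute)
  then show ?thesis using assms by (simp add: coxeter_vertex_def cut_vec_compl)
qed

text \<open>Complementation makes the polytope symmetric about the origin, so every segment from a
  point \<open>x\<close> to 0 can be prolonged within it to \<open>- x\<close>. The witness 2 is
  this prolongation.\<close>

lemma zero_rel_interior_coxeter_polytope:
  assumes "w \<in> V"
  shows "0 \<in> rel_interior (coxeter_polytope V w)"
proof -
  let ?X = "insert 0 (coxeter_vertex V w ` (Pow V - {{}, V}))"
  have neg: "uminus ` ?X \<subseteq> ?X"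
  proof
    fix x assume "x \<in> uminus ` ?X"
    then consider "x = 0" | S where "S \<in> Pow V - {{}, V}" "x = - coxeter_vertex V w S" by auto
    then show "x \<in> ?X"
    proof cases
      case 2
      then have "x = coxeter_vertex V w (V - S)" using coxeter_vertex_compl[OF assms] by simp
      then show ?thesis using 2 by blast
    qed simp
  qed
  have "- x \<in> coxeter_polytope V w" if "x \<in> coxeter_polytope V w" for x
  proof -
    have "- x \<in> convex hull (uminus ` ?X)"
      using that unfolding coxeter_polytope_def
      by (intro in_convex_hull_linear_image) (auto intro: linear_compose_neg linear_uminus)
    then show ?thesis unfolding coxeter_polytope_def using hull_mono[OF neg] by blast
  qed
  then have "\<forall>x\<in>coxeter_polytope V w. \<exists>e>1. (1 - e) *\<^sub>R x + e *\<^sub>R 0 \<in> coxeter_polytope V w"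
    by (intro ballI exI[of _ 2]) simp
  moreover have "convex (coxeter_polytope V w)" "coxeter_polytope V w \<noteq> {}"
    by (auto simp: coxeter_polytope_def)
  ultimately show ?thesis using convex_rel_interior_iff by blast
qed

text \<open>A point \<open>x\<close> in the relative interior of \<open>F\<close> is a positive
  combination over some chain \<open>C\<close>. Lying on the boundary, it has coefficients of sum 1
  and is interior to the simplex of \<open>C\<close>. Two faces whose relative interiors meet
  coincide.\<close>

lemma coxeter_face_cases:
  assumes "w \<in> V" "F face_of coxeter_polytope V w" "F \<noteq> coxeter_polytope V w"
  obtains C where "C \<in> proper_chains V" "F = convex hull (coxeter_vertex V w ` C)"
proof (cases "F = {}")
  case True
  then show ?thesis using that[of "{}"] by (auto simp: proper_chains_def chain_subset_def)
next
  case False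
  let ?P = "coxeter_polytope V w" and ?u = "coxeter_vertex V w"
  have "convex F" using assms(2) face_of_imp_convex by (auto simp: coxeter_polytope_def)
  then obtain x where x: "x \<in> rel_interior F" using False rel_interior_eq_empty by blast
  then have "x \<in> F" using rel_interior_subset by blast
  then have xP: "x \<in> ?P" using assms(2) face_of_imp_subset by blast
  then obtain C y where C: "chain\<^sub>\<subseteq> C" "C \<subseteq> Pow V - {{}, V}"
    and y: "\<forall>T\<in>C. 0 < y T"
    and rep: "x = (\<Sum>T\<in>C. y T *\<^sub>R cut_vec V w T)"
    using cut_vec_representation[of x V w] coxeter_polytope_subset assms(1) by blast
  have pc: "C \<in> proper_chains V" using C by (auto simp: proper_chains_def)
  \<comment> \<open>The coefficients of \<open>x\<close> with respect to the normalised
    vertices.\<close>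
  define z where "z T = y T * cut_size V T" for T
  have size: "0 < cut_size V T" if "T \<in> C" for T using that C cut_size_pos by blast
  then have z: "0 < z T" if "T \<in> C" for T using that y by (simp add: z_def)
  have rep_u: "x = (\<Sum>T\<in>C. z T *\<^sub>R ?u T)"
    unfolding rep by (intro sum.cong refl) (use size in \<open>force simp: z_def coxeter_vertex_def\<close>)
  have one: "sep_vec V C \<bullet> ?u T = 1" if "T \<in> C" for T
    using that C sep_vec_vertex_le(2)[OF pc, of T w] by blast
  have "sep_vec V C \<bullet> x = sum z C"
    unfolding rep_u inner_sum_right by (intro sum.cong refl) (simp add: one)
  then have le: "sum z C \<le> 1" using sep_vec_le_polytope[OF pc xP] by simp
  have "F \<inter> rel_interior ?P = {}" using assms face_of_disjoint_rel_interior by blast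
  then have not_int: "x \<notin> rel_interior ?P" using \<open>x \<in> F\<close> by blast
  \<comment> \<open>With a sum \<open>s < 1\<close>, the point \<open>x\<close> would lie strictly
    between the relatively interior point 0 and the point \<open>x / s\<close> of the polytope,
    hence in the relative interior.\<close>
  have "sum z C = 1"
  proof (rule ccontr)
    assume ne: "sum z C \<noteq> 1"
    have cv: "convex ?P" by (simp add: coxeter_polytope_def)
    have "C \<noteq> {}" using not_int zero_rel_interior_coxeter_polytope[OF assms(1)] rep by auto
    then have pos: "0 < sum z C" using z by (intro sum_pos) auto
    let ?s = "sum z C"
    have "(\<Sum>T\<in>C. (z T / ?s) *\<^sub>R ?u T) \<in> ?P"
    proof (rule convex_sum[OF _ cv])
      show "(\<Sum>T\<in>C. z T / ?s) = 1" using pos by (simp add: sum_divide_distrib[symmetric])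
      show "0 \<le> z T / ?s" if "T \<in> C" for T using z[OF that] pos by simp
      show "?u T \<in> ?P" if "T \<in> C" for T
        using that C unfolding coxeter_polytope_def by (intro hull_inc) auto
    qed simp
    also have "(\<Sum>T\<in>C. (z T / ?s) *\<^sub>R ?u T) = inverse ?s *\<^sub>R x"
      unfolding rep_u scaleR_sum_right by (intro sum.cong refl) (simp add: field_simps)
    finally have "inverse ?s *\<^sub>R x - (1 - ?s) *\<^sub>R (inverse ?s *\<^sub>R x - 0) \<in> rel_interior ?P"
      using ne le pos by (intro rel_interior_convex_shrink[OF cv]
          zero_rel_interior_coxeter_polytope assms(1)) auto
    also have "inverse ?s *\<^sub>R x - (1 - ?s) *\<^sub>R (inverse ?s *\<^sub>R x - 0) = x"
      using pos by (simp add: algebra_simps)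
    finally show False using not_int by simp
  qed
  have inj: "inj_on ?u C" using inj_on_coxeter_vertex C inj_on_subset by blast
  have "x \<in> rel_interior (convex hull (?u ` C))"
  proof -
    define c where "c p = z (inv_into C ?u p)" for p
    have c: "c (?u T) = z T" if "T \<in> C" for T using that inj by (simp add: c_def)
    have "x = (\<Sum>p\<in>?u ` C. c p *\<^sub>R p)" "sum c (?u ` C) = 1"
      using rep_u \<open>sum z C = 1\<close> by (simp_all add: sum.reindex[OF inj] c)
    moreover have "\<forall>p\<in>?u ` C. 0 < c p" using z c by auto
    ultimately show ?thesis
      using rel_interior_convex_hull_explicit[OF coxeter_vertex_independent[OF pc, of w]] by blast
  qed
  then have "F = convex hull (?u ` C)"
    using x face_of_eq[OF assms(2) coxeter_face(1)[OF pc, of w]] by blast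
  then show ?thesis using that pc by blast
qed

text \<open>As the origin belongs to the polytope, its affine dimension is its linear one, and the
  chain representation shows that the vertices span all of
  \<open>coord_space (V - {w})\<close>.\<close>

lemma aff_dim_coxeter_polytope:
  assumes "w \<in> V"
  shows "aff_dim (coxeter_polytope V w) = int (card V) - 1"
proof -
  let ?P = "coxeter_polytope V w"
  have zero: "0 \<in> ?P" by (simp add: coxeter_polytope_def hull_inc)
  have "coord_space (V - {w}) \<subseteq> span ?P"
  proof
    fix x :: "real ^ 'a set" assume "x \<in> coord_space (V - {w})"
    from cut_vec_representation[OF this assms]
    obtain C y where C: "C \<subseteq> Pow V - {{}, V}" and rep: "x = (\<Sum>T\<in>C. y T *\<^sub>R cut_vec V w T)"
      by auto
    have "cut_vec V w T \<in> span ?P" if "T \<in> C" for T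
    proof -
      have "T \<in> Pow V - {{}, V}" using that C by blast
      then have "coxeter_vertex V w T \<in> span ?P" "0 < cut_size V T"
        by (auto simp: coxeter_polytope_def intro!: span_base hull_inc cut_size_pos)
      moreover from this have "cut_vec V w T = cut_size V T *\<^sub>R coxeter_vertex V w T"
        by (simp add: coxeter_vertex_def)
      ultimately show ?thesis by (simp add: span_scale)
    qed
    then show "x \<in> span ?P" unfolding rep by (intro span_sum span_scale)
  qed
  then have "dim ?P = dim (coord_space (V - {w}))"
    using dim_subset[OF coxeter_polytope_subset, of V w] dim_subset[of "coord_space (V - {w})" "span ?P"]
    by simp
  moreover have "aff_dim ?P = int (dim ?P)"
    using zero by (intro aff_dim_zero hull_inc)
  moreover have "0 < card V" using assms by (auto simp: card_gt_0_iff)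
  ultimately show ?thesis using assms by (simp add: dim_coord_space of_nat_diff)
qed

lemma simplicial_polytope_coxeter:
  assumes "w \<in> V"
  shows "simplicial_polytope (int (card V) - 1) (coxeter_polytope V w)"
  unfolding simplicial_polytope_def
proof (intro conjI allI impI)
  show "polytope (coxeter_polytope V w)"
    unfolding coxeter_polytope_def by (rule polytope_convex_hull) simp
  show "aff_dim (coxeter_polytope V w) = int (card V) - 1"
    by (rule aff_dim_coxeter_polytope[OF assms])
  fix F assume F: "F face_of coxeter_polytope V w \<and> F \<noteq> coxeter_polytope V w"
  then obtain C where "C \<in> proper_chains V" "F = convex hull (coxeter_vertex V w ` C)"
    using coxeter_face_cases[OF assms] by blast
  then show "\<exists>k. k simplex F"
    unfolding simplex_def using coxeter_vertex_independent
    by (intro exI[of _ "int (card (coxeter_vertex V w ` C)) - 1"]) fastforce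
qed

lemma boundary_complex_coxeter:
  assumes "w \<in> V"
  shows "boundary_complex (coxeter_polytope V w) = (`) (coxeter_vertex V w) ` proper_chains V"
proof -
  let ?u = "coxeter_vertex V w"
  have ext: "{x. x extreme_point_of convex hull (?u ` C)} = ?u ` C" if "C \<in> proper_chains V" for C
    using extreme_point_of_convex_hull_affine_independent[OF coxeter_vertex_independent[OF that, of w]]
    by blast
  have "{F. F face_of coxeter_polytope V w \<and> F \<noteq> coxeter_polytope V w} =
      (\<lambda>C. convex hull (?u ` C)) ` proper_chains V" (is "?L = ?R")
  proof
    show "?L \<subseteq> ?R" by (auto elim!: coxeter_face_cases[OF assms])
    show "?R \<subseteq> ?L" using coxeter_face[of _ V w] by blast
  qed
  then show ?thesis
    unfolding boundary_complex_def using ext by (simp add: image_image cong: image_cong)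
qed

lemma polytope_boundary_proper_chains:
  assumes "V \<noteq> {}"
  shows "polytope_boundary (int (card V) - 1) (proper_chains V)"
proof -
  obtain w where w: "w \<in> V" using assms by blast
  have "inj_on (coxeter_vertex V w) (\<Union>(proper_chains V))"
    by (rule inj_on_subset[OF inj_on_coxeter_vertex]) (auto simp: proper_chains_def)
  then show ?thesis
    unfolding polytope_boundary_def
    using simplicial_polytope_coxeter[OF w] boundary_complex_coxeter[OF w] by metis
qed

section \<open>Balls of order ideals\<close>

definition ideal_chains :: "'v set \<Rightarrow> ('v \<times> 'v) set \<Rightarrow> 'v set set set" where
  "ideal_chains V g =
     {C. chain\<^sub>\<subseteq> C \<and> C \<subseteq> Pow V - {{}} \<and> (\<forall>T\<in>C. \<forall>p q. (p, q) \<in> g \<longrightarrow> q \<in> T \<longrightarrow> p \<in> T)}"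

section \<open>The geometric realization as a convex set\<close>

lemma convex_hull_axes:
  fixes C :: "'a::finite set"
  shows "convex hull ((\<lambda>x. axis x 1) ` C) =
    {y :: real ^ 'a. (\<forall>x. 0 \<le> y $ x) \<and> (\<forall>x. x \<notin> C \<longrightarrow> y $ x = 0) \<and> (\<Sum>x\<in>UNIV. y $ x) = 1}"
    (is "?L = ?R")
proof
  have "convex ?R"
    by (auto simp: convex_def sum.distrib sum_distrib_left[symmetric])
  moreover have "(\<lambda>x. axis x 1) ` C \<subseteq> ?R"
    by (auto simp: axis_def)
  ultimately show "?L \<subseteq> ?R" by (rule hull_minimal[rotated])
  show "?R \<subseteq> ?L"
  proof
    fix y assume y: "y \<in> ?R"
    have "y = (\<Sum>x\<in>C. y $ x *\<^sub>R axis x 1)"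
    proof (rule vec_eq_iff[THEN iffD2], rule allI)
      fix z
      have "(\<Sum>x\<in>C. y $ x *\<^sub>R axis x 1) $ z = (\<Sum>x\<in>C. if x = z then y $ x else 0)"
        unfolding sum_component by (intro sum.cong) (auto simp: axis_def)
      then show "y $ z = (\<Sum>x\<in>C. y $ x *\<^sub>R axis x 1) $ z" using y by auto
    qed
    also have "\<dots> \<in> ?L"
    proof (rule convex_sum)
      have "(\<Sum>x\<in>C. y $ x) = (\<Sum>x\<in>UNIV. y $ x)"
        using y by (intro sum.mono_neutral_left) auto
      then show "(\<Sum>x\<in>C. y $ x) = 1" using y by simp
    qed (use y in \<open>auto intro: hull_inc\<close>)
    finally show "y \<in> ?L" .
  qed
qed

definition cut_map :: "'v::finite set \<Rightarrow> 'v \<Rightarrow> real ^ ('v set) \<Rightarrow> real ^ ('v set)" where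
  "cut_map V w y = (\<Sum>S\<in>UNIV. y $ S *\<^sub>R cut_vec V w S)"

lemma linear_cut_map: "linear (cut_map V w)"
  by (rule linearI) (auto simp: cut_map_def scaleR_left_distrib sum.distrib scaleR_sum_right)

lemma cut_map_axis: "cut_map V w (axis S 1) = cut_vec V w S"
proof -
  have "cut_map V w (axis S 1) = (\<Sum>T\<in>UNIV. if T = S then cut_vec V w T else 0)"
    unfolding cut_map_def by (intro sum.cong) (auto simp: axis_def)
  then show ?thesis by simp
qed

text \<open>Uniqueness of the chain representation recovers every barycentric coordinate except that
  of \<open>V\<close>, whose image is 0. The last one follows because the coordinates sum to
  1.\<close>

lemma inj_on_cut_map:
  fixes K :: "'v::finite set set set"
  assumes K: "\<And>C. C \<in> K \<Longrightarrow> chain\<^sub>\<subseteq> C \<and> C \<subseteq> Pow V - {{}}" and "w \<in> V"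
  shows "inj_on (cut_map V w) (realization K)"
proof (rule inj_onI)
  fix y z :: "real ^ ('v set)"
  assume y: "y \<in> realization K" and z: "z \<in> realization K" and eq: "cut_map V w y = cut_map V w z"
  define D where "D y = {S. 0 < y $ S} - {V}" for y :: "real ^ ('v set)"
  have *: "chain\<^sub>\<subseteq> (D y) \<and> D y \<subseteq> Pow V - {{}, V} \<and> (\<forall>S. S \<notin> D y \<longrightarrow> S \<noteq> V \<longrightarrow> y $ S = 0) \<and>
      (\<Sum>S\<in>UNIV. y $ S) = 1 \<and> cut_map V w y = (\<Sum>S\<in>D y. y $ S *\<^sub>R cut_vec V w S)"
    if mem: "y \<in> realization K" for y
  proof -
    obtain C where "C \<in> K" and "y \<in> convex hull ((\<lambda>x. axis x 1) ` C)"
      using mem unfolding realization_def by (rule UN_E)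
    then have C: "C \<in> K" "\<forall>x. 0 \<le> y $ x" "\<forall>x. x \<notin> C \<longrightarrow> y $ x = 0" "(\<Sum>x\<in>UNIV. y $ x) = 1"
      unfolding convex_hull_axes by simp_all
    have sub: "D y \<subseteq> C" using C(3) unfolding D_def by force
    have zero: "y $ S = 0" if "S \<notin> D y" "S \<noteq> V" for S
      using that C(2) unfolding D_def by (simp add: order_antisym)
    have "cut_map V w y = (\<Sum>S\<in>D y. y $ S *\<^sub>R cut_vec V w S)"
      unfolding cut_map_def
    proof (rule sum.mono_neutral_right)
      show "\<forall>S\<in>UNIV - D y. y $ S *\<^sub>R cut_vec V w S = 0"
        using zero cut_vec_whole[OF assms(2)] by (metis DiffD2 scaleR_zero_left scaleR_zero_right)
    qed auto
    moreover have "chain\<^sub>\<subseteq> (D y)" using K[OF C(1)] sub chain_subset_mono by blast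
    moreover have "D y \<subseteq> Pow V - {{}, V}" using K[OF C(1)] sub unfolding D_def by blast
    ultimately show ?thesis using C(4) zero by blast
  qed
  note Y = *[OF y] and Z = *[OF z]
  have diff: "chain_diff (D y) (($) y) i j = chain_diff (D z) (($) z) i j" if "i \<in> V" "j \<in> V" for i j
  proof -
    have "cut_map V w y $ {i} - cut_map V w y $ {j} = chain_diff (D y) (($) y) i j"
      using cut_vec_sum_diff[OF that, where y="($) y" and C="D y" and w=w] Y by simp
    moreover have "cut_map V w z $ {i} - cut_map V w z $ {j} = chain_diff (D z) (($) z) i j"
      using cut_vec_sum_diff[OF that, where y="($) z" and C="D z" and w=w] Z by simp
    ultimately show ?thesis using eq by simp
  qed
  have pos: "0 < y $ T" if "T \<in> D y" for T and y using that by (auto simp: D_def)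
  have Dy: "chain\<^sub>\<subseteq> (D y)" "D y \<subseteq> Pow V - {{}, V}" and Dz: "chain\<^sub>\<subseteq> (D z)" "D z \<subseteq> Pow V - {{}, V}"
    using Y Z by simp_all
  note unique = chain_representation_unique[OF Dy pos Dz pos diff]
  have off: "y $ S = z $ S" if "S \<noteq> V" for S
    using that Y Z unique by (cases "S \<in> D y") simp_all
  have "y $ V + (\<Sum>S\<in>UNIV - {V}. y $ S) = 1" "z $ V + (\<Sum>S\<in>UNIV - {V}. z $ S) = 1"
    using Y Z by (simp_all add: sum.remove[of UNIV V])
  moreover have "(\<Sum>S\<in>UNIV - {V}. y $ S) = (\<Sum>S\<in>UNIV - {V}. z $ S)"
    using off by (intro sum.cong) auto
  ultimately have "y $ V = z $ V" by simp
  then show "y = z" using off by (metis vec_eq_iff)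
qed

text \<open>
  Order-reversing functions of oscillation at most \<open>1\<close>: the piecewise linear image of the ear,
  which is convex although the realization is not.
\<close>

definition antitone_polytope :: "'v::finite set \<Rightarrow> 'v \<Rightarrow> ('v \<times> 'v) set \<Rightarrow> (real ^ ('v set)) set" where
  "antitone_polytope V w g = {x \<in> coord_space (V - {w}).
     (\<forall>i\<in>V. \<forall>j\<in>V. x $ {i} - x $ {j} \<le> 1) \<and> (\<forall>(p, q)\<in>g. x $ {q} \<le> x $ {p})}"

lemma convex_antitone_polytope: "convex (antitone_polytope V w g)"
proof -
  have "antitone_polytope V w g = coord_space (V - {w}) \<inter>
      (\<Inter>i\<in>V. \<Inter>j\<in>V. {x. (axis {i} 1 - axis {j} 1) \<bullet> x \<le> 1}) \<inter>
      (\<Inter>p\<in>g. {x. (axis {snd p} 1 - axis {fst p} 1) \<bullet> x \<le> 0})"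
    by (force simp: antitone_polytope_def inner_diff_left inner_axis' split_beta)
  then show ?thesis
    by (simp add: convex_Int convex_INT convex_halfspace_le subspace_imp_convex
        subspace_coord_space)
qed

lemma cut_vec_in_antitone_polytope:
  assumes "g \<subseteq> V \<times> V" "\<And>p q. (p, q) \<in> g \<Longrightarrow> q \<in> S \<Longrightarrow> p \<in> S"
  shows "cut_vec V w S \<in> antitone_polytope V w g"
  using assms
  by (auto simp: antitone_polytope_def cut_vec_in_coord_space cut_vec_nth subset_iff)

text \<open>A chain representing an order-reversing function consists of ideals: a member with
  \<open>q\<close> but not \<open>p\<close> would make the value at \<open>q\<close> the larger one.
  The oscillation bound limits the sum of the coefficients, so that they become barycentric
  coordinates.\<close>

lemma cut_map_realization:
  assumes "w \<in> V" "g \<subseteq> V \<times> V"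
  shows "cut_map V w ` realization (ideal_chains V g) = antitone_polytope V w g"
proof
  show "cut_map V w ` realization (ideal_chains V g) \<subseteq> antitone_polytope V w g"
  proof -
    have "cut_map V w ` (convex hull ((\<lambda>x. axis x 1) ` C)) \<subseteq> antitone_polytope V w g"
      if "C \<in> ideal_chains V g" for C
      unfolding convex_hull_linear_image[OF linear_cut_map]
      using that assms(2)
      by (intro hull_minimal convex_antitone_polytope)
        (auto simp: cut_map_axis ideal_chains_def intro!: cut_vec_in_antitone_polytope)
    then show ?thesis unfolding realization_def by blast
  qed
  show "antitone_polytope V w g \<subseteq> cut_map V w ` realization (ideal_chains V g)"
  proof
    fix x assume x: "x \<in> antitone_polytope V w g"
    then have "x \<in> coord_space (V - {w})" by (simp add: antitone_polytope_def)
    from cut_vec_representation[OF this assms(1)] obtain C y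
      where C: "chain\<^sub>\<subseteq> C" "C \<subseteq> Pow V - {{}, V}" and y: "\<forall>T\<in>C. 0 < y T"
        and rep: "x = (\<Sum>T\<in>C. y T *\<^sub>R cut_vec V w T)" by auto
    have diff: "x $ {i} - x $ {j} = chain_diff C y i j" if "i \<in> V" "j \<in> V" for i j
      unfolding rep using that by (rule cut_vec_sum_diff)
    have ideal: "p \<in> T" if "(p, q) \<in> g" "T \<in> C" "q \<in> T" for p q T
    proof (rule ccontr)
      assume "p \<notin> T"
      then have "y T \<le> chain_diff C y q p"
        using that C(1) y by (intro chain_coeff_le_diff) (auto simp: less_imp_le)
      also have "\<dots> = x $ {q} - x $ {p}" using diff[of q p] that assms(2) by auto
      also have "\<dots> \<le> 0" using x that by (auto simp: antitone_polytope_def)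
      finally show False using y that by force
    qed
    have "chain\<^sub>\<subseteq> (insert V C)" using C unfolding chain_subset_def by blast
    moreover have "insert V C \<subseteq> Pow V - {{}}" using C assms(1) by blast
    moreover have "\<forall>T\<in>insert V C. \<forall>p q. (p, q) \<in> g \<longrightarrow> q \<in> T \<longrightarrow> p \<in> T"
      using ideal assms(2) by blast
    ultimately have IC: "insert V C \<in> ideal_chains V g" unfolding ideal_chains_def by simp
    \<comment> \<open>For \<open>i\<close> in the smallest member and \<open>j\<close> outside the
      largest one, the difference of values is the sum of all coefficients.\<close>
    have le: "sum y C \<le> 1"
    proof (cases "C = {}")
      case False
      have "\<Inter>C \<in> Pow V - {{}, V}" "\<Union>C \<in> Pow V - {{}, V}"
        using subsetD[OF C(2) chain_Inter_mem[OF C(1) False]]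
          subsetD[OF C(2) chain_Union_mem[OF C(1) False]] .
      then have "\<Inter>C \<subseteq> V" "\<Inter>C \<noteq> {}" "\<Union>C \<subset> V" by (simp_all add: psubset_eq)
      then obtain i j where i: "i \<in> \<Inter>C" "i \<in> V" and j: "j \<in> V" "j \<notin> \<Union>C"
        by (meson ex_in_conv psubsetE subsetD subsetI)
      have "sum y C = chain_diff C y i j"
        using i j by (intro sum.cong) auto
      also have "\<dots> = x $ {i} - x $ {j}" using diff[of i j] i j by simp
      also have "\<dots> \<le> 1" using x i(2) j(1) by (simp add: antitone_polytope_def)
      finally show ?thesis .
    qed simp
    \<comment> \<open>The weight missing from 1 is placed on the apex \<open>V\<close>, which
      \<open>cut_map\<close> sends to 0.\<close>
    define z :: "real ^ ('a set)"
      where "z = (\<Sum>T\<in>C. y T *\<^sub>R axis T 1) + (1 - sum y C) *\<^sub>R axis V 1"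
    have VC: "V \<notin> C" using C by blast
    have "z \<in> convex hull ((\<lambda>x. axis x 1) ` insert V C)"
    proof -
      have "z = (\<Sum>T\<in>insert V C. (if T = V then 1 - sum y C else y T) *\<^sub>R axis T 1)"
        using VC by (simp add: z_def) (intro sum.cong, auto)
      also have "\<dots> \<in> convex hull ((\<lambda>x. axis x 1) ` insert V C)"
      proof (rule convex_sum)
        have "(\<Sum>T\<in>C. if T = V then 1 - sum y C else y T) = sum y C"
          using VC by (intro sum.cong) auto
        then show "(\<Sum>T\<in>insert V C. if T = V then 1 - sum y C else y T) = 1"
          using VC by simp
      qed (use le y in \<open>auto intro: hull_inc less_imp_le\<close>)
      finally show ?thesis .
    qed
    then have "z \<in> realization (ideal_chains V g)"
      unfolding realization_def using IC by (rule UN_I[rotated])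
    moreover have "cut_map V w z = x"
      using assms(1) unfolding z_def rep
      by (simp add: linear_add[OF linear_cut_map] linear_sum[OF linear_cut_map]
          linear_scale[OF linear_cut_map] cut_map_axis cut_vec_whole)
    ultimately show "x \<in> cut_map V w ` realization (ideal_chains V g)" by blast
  qed
qed

lemma abstract_complex_ideal_chains: "abstract_complex (ideal_chains V g)"
  unfolding abstract_complex_def
proof (intro conjI ballI allI impI)
  show "{} \<in> ideal_chains V g" by (simp add: ideal_chains_def chain_subset_def)
  fix C C' assume "C \<in> ideal_chains V g" "C' \<subseteq> C"
  then show "C' \<in> ideal_chains V g"
    using chain_subset_mono[of C C'] unfolding ideal_chains_def
    by (simp add: subset_trans) (meson subsetD)
qed

text \<open>A continuous injection of a compact set is a homeomorphism onto its image, here a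
  compact convex set, and such sets are classified by affine dimension. Normalising at
  \<open>a\<close> and identifying \<open>a\<close> with \<open>b\<close> kills two coordinates,
  which bounds the dimension above; the independent vectors from \<open>D\<close> bound it
  below.\<close>

lemma simplicial_ball_ideal_chains:
  fixes V :: "'v::finite set"
  assumes ab: "a \<in> V" "b \<in> V" "a \<noteq> b" "(a, b) \<in> g" "(b, a) \<in> g" and g: "g \<subseteq> V \<times> V"
    and D: "D \<in> ideal_chains V g" "card D = card V - 1"
  shows "simplicial_ball (int (card V) - 2) (ideal_chains V g)"
proof -
  let ?Q = "antitone_polytope V a g" and ?T = "coord_space (V - {a, b})"
  have "card {a, b} \<le> card V" using ab by (intro card_mono) auto
  then have V2: "2 \<le> card V" using ab by simp
  have dimT: "int (dim ?T) = int (card V) - 2"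
    using ab V2 by (simp add: dim_coord_space card_Diff_subset of_nat_diff)
  have comp: "compact (realization (ideal_chains V g))"
    unfolding realization_def
    by (intro compact_UN finite_imp_compact_convex_hull) auto
  have hom: "realization (ideal_chains V g) homeomorphic ?Q"
  proof (rule homeomorphic_compact[OF comp _ cut_map_realization[OF ab(1) g]])
    show "continuous_on (realization (ideal_chains V g)) (cut_map V a)"
      using linear_cut_map by (metis linear_continuous_on linear_conv_bounded_linear)
    show "inj_on (cut_map V a) (realization (ideal_chains V g))"
      using ab(1) by (rule inj_on_cut_map[rotated]) (auto simp: ideal_chains_def)
  qed
  then have compQ: "compact ?Q" using comp homeomorphic_compactness by blast
  have "?Q \<subseteq> ?T"
  proof
    fix x assume x: "x \<in> ?Q"
    have "x $ {a} = 0" using x by (auto simp: antitone_polytope_def coord_space_def)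
    moreover have "x $ {b} \<le> x $ {a}" "x $ {a} \<le> x $ {b}"
      using x ab by (auto simp: antitone_polytope_def)
    ultimately have b: "x $ {b} = 0" by simp
    show "x \<in> ?T"
      unfolding coord_space_def
    proof (intro CollectI allI impI)
      fix X assume "X \<notin> (\<lambda>i. {i}) ` (V - {a, b})"
      then have "X \<notin> (\<lambda>i. {i}) ` (V - {a}) \<or> X = {b}" by auto
      then show "x $ X = 0" using x b by (auto simp: antitone_polytope_def coord_space_def)
    qed
  qed
  then have "dim ?Q \<le> dim ?T" by (rule dim_subset)
  moreover have "dim ?T \<le> dim ?Q"
  proof -
    let ?D = "D - {V}"
    have D': "chain\<^sub>\<subseteq> ?D" "?D \<subseteq> Pow V - {{}, V}"
      using D by (auto simp: ideal_chains_def chain_subset_def)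
    have ind: "inj_on (cut_vec V a) ?D" "independent (cut_vec V a ` ?D)"
      using independent_scaled_cut_vec[OF D', where c="\<lambda>_. 1" and w=a] by simp_all
    have "cut_vec V a ` ?D \<subseteq> ?Q"
      using D g by (auto simp: ideal_chains_def intro!: cut_vec_in_antitone_polytope)
    then have "card (cut_vec V a ` ?D) \<le> dim ?Q" using ind by (intro independent_card_le_dim)
    \<comment> \<open>Omitting \<open>V\<close>, whose vector is 0, costs at most one of the
      \<open>card V - 1\<close> members.\<close>
    moreover have "card V - 2 \<le> card ?D"
      using D(2) by (simp add: card_Diff_singleton_if) linarith
    ultimately show ?thesis using dimT ind V2 by (simp add: card_image)
  qed
  moreover have "0 \<in> ?Q"
    using cut_vec_in_antitone_polytope[of g V V a] g cut_vec_whole[OF ab(1)] by auto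
  ultimately have "aff_dim ?Q = int (dim ?T)"
    by (simp add: aff_dim_zero hull_inc)
  \<comment> \<open>The subspace meets the interior of the ball at 0, so the intersection keeps its
    dimension.\<close>
  also have "\<dots> = aff_dim (cball 0 1 \<inter> ?T)"
  proof -
    have "aff_dim (?T \<inter> cball 0 1) = aff_dim ?T"
      using subspace_0[OF subspace_coord_space[of "V - {a, b}"]]
      by (intro aff_dim_convex_Int_nonempty_interior subspace_imp_convex subspace_coord_space)
        (auto simp: interior_cball)
    then show ?thesis by (simp add: Int_commute aff_dim_subspace subspace_coord_space)
  qed
  finally have "?Q homeomorphic (cball 0 1 \<inter> ?T)"
    by (rule homeomorphic_convex_compact_sets[OF convex_antitone_polytope compQ
          convex_Int[OF convex_cball subspace_imp_convex[OF subspace_coord_space]]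
          compact_Int_closed[OF compact_cball closed_subspace[OF subspace_coord_space]]])
  then have "realization (ideal_chains V g) homeomorphic (cball 0 1 \<inter> ?T)"
    by (rule homeomorphic_trans[OF hom])
  then show ?thesis
    unfolding simplicial_ball_def using dimT
    by (intro conjI exI[of _ ?T] abstract_complex_ideal_chains subspace_coord_space)
qed

section \<open>Facets and boundary of an ear\<close>

text \<open>A linear extension of \<open>g\<close> in which exactly the two ends of \<open>e\<close>
  are tied. With \<open>e = {}\<close> it is injective on \<open>V\<close>.\<close>

definition rank_fun :: "'v set \<Rightarrow> 'v set \<Rightarrow> ('v \<times> 'v) set \<Rightarrow> ('v \<Rightarrow> nat) \<Rightarrow> bool" where
  "rank_fun V e g f \<longleftrightarrow> (\<forall>p\<in>V. \<forall>q\<in>V. f p = f q \<longleftrightarrow> p = q \<or> {p, q} = e) \<and>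
     (\<forall>p q. (p, q) \<in> g \<longrightarrow> f p \<le> f q)"

abbreviation segment :: "'v set \<Rightarrow> ('v \<Rightarrow> nat) \<Rightarrow> nat \<Rightarrow> 'v set" where
  "segment V f t \<equiv> {q \<in> V. f q \<le> t}"

definition segments :: "'v set \<Rightarrow> ('v \<Rightarrow> nat) \<Rightarrow> 'v set set" where
  "segments V f = segment V f ` f ` V"

lemma segments_ideal:
  assumes "rank_fun V e g f" "g \<subseteq> V \<times> V"
  shows "segments V f \<in> ideal_chains V g"
proof -
  have "chain\<^sub>\<subseteq> (segments V f)"
    unfolding chain_subset_def
  proof (intro ballI)
    fix A B assume "A \<in> segments V f" "B \<in> segments V f"
    then obtain s t where "A = segment V f s" "B = segment V f t" by (auto simp: segments_def)
    then show "A \<subseteq> B \<or> B \<subseteq> A" by (cases "s \<le> t") auto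
  qed
  moreover have "segments V f \<subseteq> Pow V - {{}}" by (auto simp: segments_def)
  moreover have "p \<in> T" if "T \<in> segments V f" "(p, q) \<in> g" "q \<in> T" for p q T
  proof -
    have "f p \<le> f q" "p \<in> V" using assms that by (auto simp: rank_fun_def)
    then show ?thesis using that by (auto simp: segments_def)
  qed
  ultimately show ?thesis unfolding ideal_chains_def by simp
qed

lemma card_segments: "card (segments V f) = card (f ` V)"
proof -
  have "inj_on (segment V f) (f ` V)"
  proof (rule inj_onI)
    fix s t assume st: "s \<in> f ` V" "t \<in> f ` V" "segment V f s = segment V f t"
    then obtain p q where "p \<in> V" "q \<in> V" "s = f p" "t = f q" by blast
    moreover from this st(3) have "p \<in> segment V f t" "q \<in> segment V f s" by auto
    ultimately show "s = t" by simp
  qed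
  then show ?thesis by (simp add: segments_def card_image)
qed

text \<open>\<open>b\<close> repeats the value of \<open>a\<close>, and without \<open>b\<close> the
  ranking is injective.\<close>

lemma card_rank_image:
  assumes "rank_fun V {a, b} g f" "a \<in> V" "b \<in> V" "a \<noteq> b"
  shows "card (f ` V) = card V - 1"
proof -
  have "f a = f b" using assms by (simp add: rank_fun_def)
  then have "f b \<in> f ` (V - {b})" using assms(2,4) by (intro image_eqI[of _ _ a]) auto
  then have "f ` V = f ` (V - {b})" using assms(3) by auto
  moreover have "inj_on f (V - {b})"
    using assms(1) by (auto simp: inj_on_def rank_fun_def doubleton_eq_iff)
  ultimately show ?thesis using assms by (simp add: card_image)
qed

text \<open>Order the points lexicographically, first by the number of members that omit them and
  then by \<open>r\<close>. The members of \<open>C\<close> become initial segments, and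
  \<open>r\<close> breaks the remaining ties; the ends of \<open>e\<close> stay tied because no
  member separates them.\<close>

lemma ideal_chain_extends:
  fixes C :: "'v::finite set set"
  assumes C: "C \<in> ideal_chains V g" and r: "rank_fun V e g r"
    and sat: "\<And>T. T \<in> C \<Longrightarrow> e \<subseteq> T \<or> e \<inter> T = {}"
  obtains f where "rank_fun V e g f" "C \<subseteq> segments V f"
proof
  have chain: "chain\<^sub>\<subseteq> C" and sub: "C \<subseteq> Pow V - {{}}"
    and ideal: "\<And>T p q. T \<in> C \<Longrightarrow> (p, q) \<in> g \<Longrightarrow> q \<in> T \<Longrightarrow> p \<in> T"
    using C by (auto simp: ideal_chains_def)
  \<comment> \<open>Exceeding all values of \<open>r\<close>, the factor keeps the second criterion
    from overriding the first and lets \<open>r\<close> be recovered modulo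
    \<open>M\<close>.\<close>
  define M where "M = Suc (Max (range r))"
  define f where "f p = card {T \<in> C. p \<notin> T} * M + r p" for p
  have rM: "r p < M" for p by (simp add: M_def less_Suc_eq_le)
  then have f_mod: "f p mod M = r p" for p by (simp add: f_def)
  have less: "f p < f q" if "T \<in> C" "p \<in> T" "q \<notin> T" for p q T
  proof -
    have "{T \<in> C. p \<notin> T} \<subset> {T \<in> C. q \<notin> T}"
      using that chain unfolding chain_subset_def by blast
    then have "Suc (card {T \<in> C. p \<notin> T}) \<le> card {T \<in> C. q \<notin> T}"
      by (intro Suc_leI psubset_card_mono) auto
    then have "Suc (card {T \<in> C. p \<notin> T}) * M \<le> card {T \<in> C. q \<notin> T} * M"
      by (rule mult_le_mono1)
    then show ?thesis using rM[of p] by (simp add: f_def)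
  qed
  show "rank_fun V e g f"
    unfolding rank_fun_def
  proof (intro conjI ballI allI impI)
    fix p q assume V: "p \<in> V" "q \<in> V"
    have "r p = r q \<longleftrightarrow> p = q \<or> {p, q} = e" using r V by (simp add: rank_fun_def)
    moreover have "f p = f q" if "{p, q} = e"
    proof -
      have "{T \<in> C. p \<notin> T} = {T \<in> C. q \<notin> T}" using sat that by blast
      then show ?thesis using calculation that by (simp add: f_def)
    qed
    ultimately show "f p = f q \<longleftrightarrow> p = q \<or> {p, q} = e" using f_mod by metis
  next
    fix p q assume pq: "(p, q) \<in> g"
    then have "card {T \<in> C. p \<notin> T} \<le> card {T \<in> C. q \<notin> T}"
      using ideal by (intro card_mono) auto
    then show "f p \<le> f q" using r pq by (simp add: f_def rank_fun_def add_mono)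
  qed
  show "C \<subseteq> segments V f"
  proof
    fix T assume T: "T \<in> C"
    then have "T \<subseteq> V" "T \<noteq> {}" using sub by auto
    define t where "t = Max (f ` T)"
    have "t \<in> f ` T" using \<open>T \<noteq> {}\<close> unfolding t_def by (intro Max_in) auto
    moreover have "T = segment V f t"
    proof
      show "T \<subseteq> segment V f t" using \<open>T \<subseteq> V\<close> by (auto simp: t_def)
      show "segment V f t \<subseteq> T" using less[OF T] \<open>t \<in> f ` T\<close> by force
    qed
    ultimately show "T \<in> segments V f" using \<open>T \<subseteq> V\<close> unfolding segments_def by blast
  qed
qed

section \<open>Flips between adjacent facets\<close>

definition swap_values :: "nat \<Rightarrow> nat \<Rightarrow> nat \<Rightarrow> nat" where
  "swap_values s t u = (if u = s then t else if u = t then s else u)"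

text \<open>No rank lies between \<open>s\<close> and \<open>t\<close>, so the swap changes only the
  initial segment at \<open>s\<close>. It can violate only pairs that go from rank \<open>s\<close>
  to rank \<open>t\<close>, which are excluded.\<close>

lemma swap_adjacent_ranks:
  assumes f: "rank_fun V e g f" and st: "s \<in> f ` V" "t \<in> f ` V" "s < t"
    and adj: "\<forall>z\<in>V. f z \<le> s \<or> t \<le> f z"
    and g: "g \<subseteq> V \<times> V" "\<forall>x y. (x, y) \<in> g \<longrightarrow> f x = s \<longrightarrow> f y \<noteq> t"
  shows "rank_fun V e g (swap_values s t \<circ> f)"
    and "segments V f - {segment V f s} \<subseteq> segments V (swap_values s t \<circ> f)"
    and "segments V (swap_values s t \<circ> f) \<noteq> segments V f"
proof -
  let ?f = "swap_values s t \<circ> f"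
  have inj: "swap_values s t u = swap_values s t u' \<longleftrightarrow> u = u'" for u u'
    by (auto simp: swap_values_def)
  have image: "?f ` V = f ` V"
  proof
    show "?f ` V \<subseteq> f ` V" using st by (auto simp: swap_values_def)
    show "f ` V \<subseteq> ?f ` V"
    proof
      fix u assume "u \<in> f ` V"
      then have "swap_values s t u \<in> f ` V" using st by (auto simp: swap_values_def)
      then obtain z where "z \<in> V" "swap_values s t u = f z" by blast
      then have "?f z = u" using inj by (metis comp_apply swap_values_def)
      then show "u \<in> ?f ` V" using \<open>z \<in> V\<close> by blast
    qed
  qed
  have mono: "?f x \<le> ?f y" if "(x, y) \<in> g" for x y
  proof -
    have "f x \<le> f y" using f that by (auto simp: rank_fun_def)
    moreover have "x \<in> V" "y \<in> V" using that g(1) by auto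
    ultimately show ?thesis
      using adj g(2) that st(3) by (auto simp: swap_values_def)
  qed
  show "rank_fun V e g ?f"
    using f mono by (simp add: rank_fun_def inj)
  have seg: "segment V ?f u = segment V f u" if "u \<in> f ` V" "u \<noteq> s" for u
  proof -
    have "u < s \<or> t \<le> u" using adj that by force
    then show ?thesis using st(3) adj by (auto simp: swap_values_def split: if_splits)
  qed
  show "segments V f - {segment V f s} \<subseteq> segments V ?f"
  proof
    fix T assume T: "T \<in> segments V f - {segment V f s}"
    then obtain u where u: "u \<in> f ` V" "T = segment V f u" unfolding segments_def by blast
    with T have "u \<noteq> s" by blast
    then have "T = segment V ?f u" using u seg by simp
    moreover have "u \<in> ?f ` V" using u image by simp
    ultimately show "T \<in> segments V ?f" unfolding segments_def by blast
  qed
  obtain p z where pz: "p \<in> V" "f p = s" "z \<in> V" "f z = t" using st by blast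
  have "segment V ?f s \<in> segments V ?f"
    unfolding segments_def image using st by blast
  moreover have "segment V ?f s \<notin> segments V f"
  proof
    assume "segment V ?f s \<in> segments V f"
    then obtain u where u: "segment V ?f s = segment V f u" unfolding segments_def by blast
    have "z \<in> segment V ?f s" using pz st(3) by (auto simp: swap_values_def)
    then have "p \<in> segment V f u" using pz st(3) unfolding u by auto
    then have "p \<in> segment V ?f s" using u by blast
    then show False using pz st(3) by (auto simp: swap_values_def)
  qed
  ultimately show "segments V ?f \<noteq> segments V f" by blast
qed

lemma V_in_segments:
  fixes V :: "'v::finite set"
  assumes "V \<noteq> {}"
  shows "V \<in> segments V f"
proof -
  let ?t = "Max (f ` V)"
  have "?t \<in> f ` V" using assms by (intro Max_in) auto
  then have "segment V f ?t \<in> segments V f" unfolding segments_def by (rule imageI)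
  moreover have "segment V f ?t = V" by auto
  ultimately show ?thesis by simp
qed

text \<open>For an edge \<open>f\<close> this says that it lies in one block of the ordered set
  partition: no member of the chain separates its ends.\<close>

definition unsplit :: "'v set set \<Rightarrow> 'v set \<Rightarrow> bool" where
  "unsplit C f \<longleftrightarrow> (\<forall>T\<in>C. f \<subseteq> T \<or> f \<inter> T = {})"

lemma unsplitD: "unsplit C f \<Longrightarrow> T \<in> C \<Longrightarrow> f \<subseteq> T \<or> f \<inter> T = {}"
  by (simp add: unsplit_def)

text \<open>
  The ranking \<open>r\<close> is a generic point of the hyperplane \<open>x\<^sub>a = x\<^sub>b\<close> and selects a region of the
  arrangement of \<open>F\<close> restricted to it, in the form of an orientation of every edge of \<open>F\<close>.
\<close>

locale ear =
  fixes V :: "'v::finite set" and F :: "'v set set" and a b :: 'v and r :: "'v \<Rightarrow> nat"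
  assumes ab: "a \<in> V" "b \<in> V" "a \<noteq> b"
    and edges: "\<And>f. f \<in> F \<Longrightarrow> f \<subseteq> V \<and> card f = 2" "{a, b} \<notin> F"
    and generic: "\<And>p q. p \<in> V \<Longrightarrow> q \<in> V \<Longrightarrow> r p = r q \<longleftrightarrow> p = q \<or> {p, q} = {a, b}"
begin

text \<open>The pair \<open>a\<close>, \<open>b\<close> occurs in both directions, so an ideal
  contains both or neither. Each edge of \<open>F\<close> occurs once, oriented by
  \<open>r\<close>.\<close>

definition precedes :: "('v \<times> 'v) set" where
  "precedes = {(p, q). {p, q} = {a, b} \<or> {p, q} \<in> F \<and> r p < r q}"

abbreviation K :: "'v set set set" where
  "K \<equiv> ideal_chains V precedes"

abbreviation ranking :: "('v \<Rightarrow> nat) \<Rightarrow> bool" where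
  "ranking \<equiv> rank_fun V {a, b} precedes"

lemma V_nonempty: "V \<noteq> {}"
  using ab by blast

lemma precedes_subset: "precedes \<subseteq> V \<times> V"
  unfolding precedes_def using ab edges by (auto simp: doubleton_eq_iff)

lemma ranking_r: "ranking r"
proof -
  have "r a = r b" using generic ab by blast
  then show ?thesis
    unfolding rank_fun_def precedes_def using generic by (auto simp: doubleton_eq_iff)
qed

lemma ranking_pair_eq:
  assumes "ranking f" "{p, q} = {a, b}"
  shows "f p = f q"
proof -
  have "f a = f b" using assms ab by (simp add: rank_fun_def)
  then show ?thesis using assms(2) by (auto simp: doubleton_eq_iff)
qed

text \<open>Only \<open>a\<close> and \<open>b\<close> may share a rank, and \<open>{a, b}\<close>
  is not in \<open>F\<close>.\<close>

lemma ranking_less: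
  assumes "ranking f" "(p, q) \<in> precedes" "{p, q} \<in> F"
  shows "f p < f q"
proof -
  have "p \<in> V" "q \<in> V" using assms precedes_subset by auto
  moreover have "p \<noteq> q" "{p, q} \<noteq> {a, b}" using assms(3) edges(1)[OF assms(3)] edges(2) by auto
  ultimately have "f p \<noteq> f q" using assms(1) by (auto simp: rank_fun_def)
  moreover have "f p \<le> f q" using assms by (auto simp: rank_fun_def)
  ultimately show ?thesis by simp
qed

lemma ranking_eq_mem:
  assumes "ranking f" "C \<in> K" "T \<in> C" "p \<in> V" "q \<in> V" "f p = f q" "p \<in> T"
  shows "q \<in> T"
proof (cases "p = q")
  case False
  then have "(q, p) \<in> precedes" using assms by (auto simp: rank_fun_def precedes_def)
  then show ?thesis using assms by (auto simp: ideal_chains_def)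
qed (use assms in simp)

lemma K_saturated:
  assumes "C \<in> K" "T \<in> C"
  shows "{a, b} \<subseteq> T \<or> {a, b} \<inter> T = {}"
proof -
  have "r a = r b" using ranking_pair_eq[OF ranking_r] by simp
  then have "a \<in> T \<longleftrightarrow> b \<in> T"
    using ranking_eq_mem[OF ranking_r assms, of a b] ranking_eq_mem[OF ranking_r assms, of b a] ab
    by auto
  then show ?thesis by blast
qed

lemma K_extends:
  assumes "C \<in> K"
  obtains f where "ranking f" "C \<subseteq> segments V f"
  using ideal_chain_extends[OF assms ranking_r K_saturated[OF assms]] by blast

lemma segments_in_K: "ranking f \<Longrightarrow> segments V f \<in> K"
  using segments_ideal precedes_subset by blast

lemma card_segments_ranking: "ranking f \<Longrightarrow> card (segments V f) = card V - 1"
  using card_rank_image ab by (simp add: card_segments)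

text \<open>Every chain of the ear extends to the initial segments of some ranking, and these all
  have the same number of members, so none contains another properly.\<close>

lemma complex_facets_K: "complex_facets K = segments V ` {f. ranking f}"
proof (intro equalityI subsetI)
  fix G assume G: "G \<in> complex_facets K"
  then obtain f where "ranking f" "G \<subseteq> segments V f"
    using K_extends unfolding complex_facets_def by blast
  then show "G \<in> segments V ` {f. ranking f}"
    using G segments_in_K unfolding complex_facets_def by blast
next
  fix G assume "G \<in> segments V ` {f. ranking f}"
  then obtain f where f: "ranking f" "G = segments V f" by blast
  have "H = G" if H: "H \<in> K" "G \<subseteq> H" for H
  proof -
    obtain f' where f': "ranking f'" "H \<subseteq> segments V f'" using H K_extends by blast
    then have "G = segments V f'"
      using f H by (intro card_subset_eq) (auto simp: card_segments_ranking)
    then show ?thesis using f' H by blast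
  qed
  then show "G \<in> complex_facets K" using f segments_in_K unfolding complex_facets_def by blast
qed

lemma facetI: "ranking f \<Longrightarrow> segments V f \<in> complex_facets K"
  unfolding complex_facets_K by simp

lemma facetE:
  assumes "G \<in> complex_facets K"
  obtains f where "ranking f" "G = segments V f"
  using assms unfolding complex_facets_K by (elim imageE) simp

lemma pure_K: "pure_complex (int (card V) - 2) K"
proof -
  have "0 < card V" using ab by (auto simp: card_gt_0_iff)
  then have "int (card (segments V f)) - 1 = int (card V) - 2" if "ranking f" for f
    using card_segments_ranking[OF that] by simp
  then show ?thesis
    unfolding pure_complex_def complex_facets_K using abstract_complex_ideal_chains by simp
qed

lemma simplicial_ball_K: "simplicial_ball (int (card V) - 2) K"
proof (rule simplicial_ball_ideal_chains[OF ab _ _ precedes_subset segments_in_K[OF ranking_r]])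
  show "(a, b) \<in> precedes" "(b, a) \<in> precedes" by (auto simp: precedes_def)
  show "card (segments V r) = card V - 1" by (rule card_segments_ranking[OF ranking_r])
qed

section \<open>The boundary of the ear\<close>

lemma ball_boundary_KI:
  assumes "R \<in> K" "C \<subseteq> R" "\<exists>!G. G \<in> complex_facets K \<and> R \<subseteq> G \<and> card G = Suc (card R)"
  shows "C \<in> ball_boundary K"
  unfolding ball_boundary_def using assms by (intro CollectI bexI[of _ R] conjI)

lemma K_subset: "R \<in> K \<Longrightarrow> C \<subseteq> R \<Longrightarrow> C \<in> K"
  using abstract_complex_ideal_chains[of V precedes] unfolding abstract_complex_def by simp

text \<open>Otherwise \<open>R\<close> lies in a second facet. The member \<open>X\<close> missing
  from \<open>R\<close> is not \<open>V\<close>, so its rank \<open>s\<close> has a successor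
  \<open>t\<close>. An edge from rank \<open>s\<close> to rank \<open>t\<close> could be separated
  by \<open>X\<close> alone, yet \<open>C\<close> splits every edge without using \<open>X\<close>.
  The two ranks may therefore be swapped.\<close>

lemma boundary_subset:
  assumes R: "R \<in> K" "C \<subseteq> R"
    and uniq: "\<exists>!G. G \<in> complex_facets K \<and> R \<subseteq> G \<and> card G = Suc (card R)"
    and V: "V \<in> C"
  shows "\<exists>f\<in>F. unsplit C f"
proof (rule ccontr)
  assume split: "\<not> (\<exists>f\<in>F. unsplit C f)"
  obtain G where G: "G \<in> complex_facets K" "R \<subseteq> G" "card G = Suc (card R)" using uniq by blast
  then obtain f where f: "ranking f" "G = segments V f" by (blast elim: facetE)
  have "G \<noteq> R" using G(3) by auto
  then obtain X where X: "X \<in> G" "X \<notin> R" using G(2) by blast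
  then obtain s where s: "s \<in> f ` V" "X = segment V f s" using f unfolding segments_def by blast
  have "X \<noteq> V" using X V R by blast
  then have ne: "{u \<in> f ` V. s < u} \<noteq> {}" using s by force
  define t where "t = Min {u \<in> f ` V. s < u}"
  have t: "t \<in> f ` V" "s < t" using Min_in[OF _ ne] unfolding t_def by auto
  have adj: "f z \<le> s \<or> t \<le> f z" if "z \<in> V" for z
  proof (cases "f z \<le> s")
    case False
    then show ?thesis using that unfolding t_def by (intro disjI2 Min_le) auto
  qed simp
  have no: "f y \<noteq> t" if xy: "(x, y) \<in> precedes" "f x = s" for x y
  proof
    assume y: "f y = t"
    have xyV: "x \<in> V" "y \<in> V" using xy precedes_subset by auto
    have "{x, y} \<noteq> {a, b}" using ranking_pair_eq[OF f(1), of x y] xy(2) y t(2) by auto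
    then have "{x, y} \<in> F" using xy by (auto simp: precedes_def)
    then obtain T where T: "T \<in> C" "\<not> {x, y} \<subseteq> T" "{x, y} \<inter> T \<noteq> {}"
      using split unfolding unsplit_def by blast
    then have TG: "T \<in> R" "T \<in> segments V f" using R G f by auto
    then obtain u where u: "u \<in> f ` V" "T = segment V f u" unfolding segments_def by blast
    have "u \<noteq> s" using TG X s u by blast
    then have "u < s \<or> t \<le> u" using adj u by force
    then show False using T xyV xy(2) y t(2) unfolding u by auto
  qed
  have adj': "\<forall>z\<in>V. f z \<le> s \<or> t \<le> f z"
    and no': "\<forall>x y. (x, y) \<in> precedes \<longrightarrow> f x = s \<longrightarrow> f y \<noteq> t"
    using adj no by blast+
  note swap = swap_adjacent_ranks[OF f(1) s(1) t(1,2) adj' precedes_subset no']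
  let ?G = "segments V (swap_values s t \<circ> f)"
  have "?G \<in> complex_facets K" using swap(1) by (rule facetI)
  moreover have "R \<subseteq> ?G" using swap(2) G f X s by blast
  moreover have "card ?G = Suc (card R)"
    using G(3) f swap(1) by (simp add: card_segments_ranking)
  ultimately have "?G = G" using uniq G by blast
  then show False using swap(3) f by blast
qed

text \<open>
  If the rank just above \<open>p\<close> is not that of \<open>q\<close>, then either an edge joins these two adjacent ranks,
  and it replaces \<open>{p, q}\<close>, or the two ranks may be swapped; both shrink the gap \<open>f q - f p\<close>.
\<close>

lemma adjacent_unsplit_pair:
  assumes "ranking f" "C \<subseteq> segments V f" "(p, q) \<in> precedes" "{p, q} \<in> F" "unsplit C {p, q}"
  shows "\<exists>f p q. ranking f \<and> C \<subseteq> segments V f \<and> (p, q) \<in> precedes \<and> {p, q} \<in> F \<and>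
    unsplit C {p, q} \<and> (\<forall>z\<in>V. f z \<le> f p \<or> f q \<le> f z)"
  using assms
proof (induction "f q - f p" arbitrary: f p q rule: less_induct)
  case (less f p q)
  show ?case
  proof (cases "\<forall>z\<in>V. f z \<le> f p \<or> f q \<le> f z")
    case True
    then show ?thesis using less.prems by blast
  next
    case False
    have pqV: "p \<in> V" "q \<in> V" using less.prems precedes_subset by auto
    have pq: "f p < f q" using ranking_less less.prems by blast
    let ?U = "{u \<in> f ` V. f p < u}"
    have ne: "?U \<noteq> {}" using pq pqV by auto
    define t where "t = Min ?U"
    have t: "t \<in> f ` V" "f p < t" using Min_in[OF _ ne] unfolding t_def by auto
    have adj: "f z \<le> f p \<or> t \<le> f z" if "z \<in> V" for z
    proof (cases "f z \<le> f p")
      case False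
      then show ?thesis using that unfolding t_def by (intro disjI2 Min_le) auto
    qed simp
    have tq: "t < f q" using False adj by force
    \<comment> \<open>Since \<open>C\<close> does not split \<open>{p, q}\<close>, none of its
      members ends at a rank from \<open>f p\<close> up to just below \<open>f q\<close>. Losing the
      segment at \<open>f p\<close> in a swap, or passing to an edge within these ranks, therefore
      keeps the conditions on \<open>C\<close>.\<close>
    have seg: "u < f p \<or> f q \<le> u" if "segment V f u \<in> C" for u
    proof -
      have "{p, q} \<subseteq> segment V f u \<or> {p, q} \<inter> segment V f u = {}"
        by (rule unsplitD[OF less.prems(5) that])
      then show ?thesis using pqV by auto
    qed
    show ?thesis
    proof (cases "\<exists>x y. (x, y) \<in> precedes \<and> f x = f p \<and> f y = t")
      case True
      then obtain x y where xy: "(x, y) \<in> precedes" "f x = f p" "f y = t" by blast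
      have xyV: "x \<in> V" "y \<in> V" using xy precedes_subset by auto
      have "{x, y} \<noteq> {a, b}" using ranking_pair_eq[OF less.prems(1), of x y] xy(2,3) t(2) by auto
      then have xyF: "{x, y} \<in> F" using xy by (auto simp: precedes_def)
      have "unsplit C {x, y}"
        unfolding unsplit_def
      proof
        fix T assume T: "T \<in> C"
        then obtain u where u: "T = segment V f u"
          using less.prems(2) unfolding segments_def by blast
        then have "u < f p \<or> f q \<le> u" using seg[of u] T by simp
        then show "{x, y} \<subseteq> T \<or> {x, y} \<inter> T = {}" using xy xyV tq t(2) pq unfolding u by auto
      qed
      moreover have "f y - f x < f q - f p" using xy tq t(2) by auto
      ultimately show ?thesis using less.hyps[of f y x] less.prems xy(1) xyF by blast
    next
      case no: False
      have s: "f p \<in> f ` V" using pqV by blast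
      have no': "\<forall>x y. (x, y) \<in> precedes \<longrightarrow> f x = f p \<longrightarrow> f y \<noteq> t" using no by blast
      have adj': "\<forall>z\<in>V. f z \<le> f p \<or> t \<le> f z" using adj by blast
      note swap = swap_adjacent_ranks[OF less.prems(1) s t adj' precedes_subset no']
      let ?f = "swap_values (f p) t \<circ> f"
      have "segment V f (f p) \<notin> C" using seg[of "f p"] pq by auto
      then have "C \<subseteq> segments V ?f" using swap(2) less.prems(2) by blast
      \<comment> \<open>The swap raises \<open>p\<close> to rank \<open>t\<close>, while
        \<open>q\<close> keeps its rank because \<open>t < f q\<close>.\<close>
      moreover have "?f q - ?f p < f q - f p"
        using tq t(2) pq by (auto simp: swap_values_def)
      ultimately show ?thesis
        using less.hyps[of ?f q p] swap(1) less.prems(3-5) by blast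
    qed
  qed
qed

text \<open>Every facet contains \<open>V\<close>, so a facet with \<open>V\<close> removed lies in
  no other facet.\<close>

lemma boundary_superset_whole:
  assumes "C \<in> K" "V \<notin> C"
  shows "C \<in> ball_boundary K"
proof -
  obtain f where f: "ranking f" "C \<subseteq> segments V f" using K_extends assms by blast
  let ?R = "segments V f - {V}"
  have "?R \<in> K" using K_subset[OF segments_in_K[OF f(1)]] by simp
  moreover have "\<exists>!G. G \<in> complex_facets K \<and> ?R \<subseteq> G \<and> card G = Suc (card ?R)"
  proof (rule ex1I[of _ "segments V f"])
    have c: "card (segments V f) = Suc (card ?R)"
      using V_in_segments[OF V_nonempty, of f] by (intro card.remove) auto
    then show "segments V f \<in> complex_facets K \<and> ?R \<subseteq> segments V f \<and>
        card (segments V f) = Suc (card ?R)"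
      using facetI[OF f(1)] by blast
    fix G assume G: "G \<in> complex_facets K \<and> ?R \<subseteq> G \<and> card G = Suc (card ?R)"
    then have "V \<in> G" using V_in_segments[OF V_nonempty] by (blast elim: facetE)
    then have "segments V f \<subseteq> G" using G by blast
    then show "G = segments V f" using G c by (intro card_subset_eq[symmetric]) auto
  qed
  moreover have "C \<subseteq> ?R" using f assms by blast
  ultimately show ?thesis using ball_boundary_KI by simp
qed

text \<open>Bring the ends of an unsplit edge to adjacent ranks and drop the segment
  \<open>?X\<close> that separates them. Every facet must separate this oriented edge again, and the
  remaining segments leave \<open>?X\<close> as the only way to do so.\<close>

lemma boundary_superset_unsplit:
  assumes C: "C \<in> K" and e: "e \<in> F" "unsplit C e"
  shows "C \<in> ball_boundary K"
proof -
  obtain p q where pq: "e = {p, q}" "p \<noteq> q" using edges e by (meson card_2_iff)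
  have "p \<in> V" "q \<in> V" "{p, q} \<noteq> {a, b}" using edges e pq by auto
  then have "r p \<noteq> r q" using generic pq by blast
  then have or: "(p, q) \<in> precedes \<or> (q, p) \<in> precedes"
    using e pq unfolding precedes_def by (auto simp: insert_commute)
  obtain f0 where f0: "ranking f0" "C \<subseteq> segments V f0" using K_extends C by blast
  have "\<exists>f p q. ranking f \<and> C \<subseteq> segments V f \<and> (p, q) \<in> precedes \<and> {p, q} \<in> F \<and>
      unsplit C {p, q} \<and> (\<forall>z\<in>V. f z \<le> f p \<or> f q \<le> f z)"
    using or
  proof
    assume "(p, q) \<in> precedes"
    then show ?thesis using e pq by (intro adjacent_unsplit_pair[OF f0, of p q]) simp_all
  next
    assume "(q, p) \<in> precedes"
    then show ?thesis
      using e pq by (intro adjacent_unsplit_pair[OF f0, of q p]) (simp_all add: insert_commute)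
  qed
  then obtain f p q where f: "ranking f" "C \<subseteq> segments V f"
    and pq: "(p, q) \<in> precedes" "{p, q} \<in> F" "unsplit C {p, q}"
    and adj: "\<forall>z\<in>V. f z \<le> f p \<or> f q \<le> f z"
    by blast
  have pqV: "p \<in> V" "q \<in> V" using pq precedes_subset by auto
  have less: "f p < f q" using ranking_less f pq by blast
  let ?X = "segment V f (f p)" and ?G = "segments V f"
  let ?R = "?G - {?X}"
  have XG: "?X \<in> ?G" using pqV unfolding segments_def by blast
  have mem_R: "segment V f u \<in> ?R" if "u \<in> f ` V" "u \<noteq> f p" for u
  proof -
    have "u < f p \<or> f p < u" using that by auto
    then have "segment V f u \<noteq> ?X" using that pqV by force
    then show ?thesis using that unfolding segments_def by blast
  qed
  have "?X \<notin> C" using unsplitD[OF pq(3), of ?X] pqV less by auto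
  then have CR: "C \<subseteq> ?R" using f by blast
  have RK: "?R \<in> K" using K_subset[OF segments_in_K[OF f(1)]] by simp
  have c: "card ?G = Suc (card ?R)" using XG by (intro card.remove) auto
  have "\<exists>!G. G \<in> complex_facets K \<and> ?R \<subseteq> G \<and> card G = Suc (card ?R)"
  proof (rule ex1I[of _ ?G])
    show "?G \<in> complex_facets K \<and> ?R \<subseteq> ?G \<and> card ?G = Suc (card ?R)"
      using facetI[OF f(1)] c by blast
    fix G assume G: "G \<in> complex_facets K \<and> ?R \<subseteq> G \<and> card G = Suc (card ?R)"
    then obtain f' where f': "ranking f'" "G = segments V f'" by (blast elim: facetE)
    have RG: "?R \<subseteq> G" using G by simp
    have GK: "G \<in> K" using segments_in_K f' by blast
    then have chain: "A \<subseteq> B \<or> B \<subseteq> A" if "A \<in> G" "B \<in> G" for A B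
      using that by (auto simp: ideal_chains_def chain_subset_def)
    \<comment> \<open>The member of the other facet that ends at \<open>p\<close>. It omits
      \<open>q\<close>, so it lies inside the segment at \<open>f q\<close> and avoids that whole
      rank. It contains \<open>p\<close>, hence all of its rank and all earlier segments. As no rank
      lies in between, it equals \<open>?X\<close>.\<close>
    let ?Y = "segment V f' (f' p)"
    have YG: "?Y \<in> G" using pqV f' unfolding segments_def by blast
    have pY: "p \<in> ?Y" "q \<notin> ?Y" using pqV ranking_less[OF f'(1) pq(1,2)] by auto
    have "?Y = ?X"
    proof (intro equalityI subsetI)
      fix z assume z: "z \<in> ?Y"
      have "segment V f (f q) \<in> G" using less pqV by (intro subsetD[OF RG] mem_R) auto
      then have "?Y \<subseteq> segment V f (f q)" using chain[OF YG] pqV pY by blast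
      then have "f z \<le> f q" "z \<in> V" using z by auto
      moreover have "f z \<noteq> f q"
        using ranking_eq_mem[OF f(1) GK YG _ pqV(2)] z pY(2) \<open>z \<in> V\<close> by blast
      ultimately show "z \<in> ?X" using adj by force
    next
      fix z assume z: "z \<in> ?X"
      show "z \<in> ?Y"
      proof (cases "f z = f p")
        case True
        then show ?thesis using ranking_eq_mem[OF f(1) GK YG pqV(1)] z pY(1) by simp
      next
        case False
        then have "segment V f (f z) \<in> G" using z by (intro subsetD[OF RG] mem_R) auto
        moreover have "p \<notin> segment V f (f z)" "z \<in> segment V f (f z)" using False z by auto
        ultimately show ?thesis using chain[OF YG] pY(1) by blast
      qed
    qed
    then have "?G \<subseteq> G" using G YG by auto
    then show "G = ?G" using G c by (intro card_subset_eq[symmetric]) auto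
  qed
  then show ?thesis by (rule ball_boundary_KI[OF RK CR])
qed

text \<open>The right-hand side is the part of the ear inside \<open>colored_chains V F\<close>,
  that is, its intersection with what was built before.\<close>

lemma ball_boundary_K: "ball_boundary K = {C \<in> K. V \<notin> C \<or> (\<exists>f\<in>F. unsplit C f)}"
proof (intro equalityI subsetI)
  fix C assume "C \<in> ball_boundary K"
  then obtain R where R: "R \<in> K" "C \<subseteq> R"
    "\<exists>!G. G \<in> complex_facets K \<and> R \<subseteq> G \<and> card G = Suc (card R)"
    unfolding ball_boundary_def by blast
  then have "C \<in> K" using K_subset by blast
  then show "C \<in> {C \<in> K. V \<notin> C \<or> (\<exists>f\<in>F. unsplit C f)}" using boundary_subset[OF R] by blast
qed (use boundary_superset_whole boundary_superset_unsplit in blast)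

text \<open>Adjoining \<open>a\<close> to an ideal loses nothing, because \<open>b\<close> still
  records whether \<open>a\<close> was present; this is how \<open>h\<close> inverts
  \<open>\<psi>\<close>. The set \<open>V\<close>, which is no vertex of the Coxeter complex, goes
  to \<open>{a}\<close>, the least of the images. All images contain \<open>a\<close>, so the vertex
  \<open>{b}\<close> is missed and the subcomplex is proper.\<close>

lemma proper_in_polytope_boundary_K: "proper_in_polytope_boundary (int (card V) - 1) K"
proof -
  define \<psi> where "\<psi> S = (if S = V then {a} else insert a S)" for S
  let ?u = "coxeter_vertex V a"
  have mem: "S \<subseteq> V \<and> S \<noteq> {} \<and> (a \<in> S \<longleftrightarrow> b \<in> S)" if "C \<in> K" "S \<in> C" for C S
  proof -
    have "S \<subseteq> V \<and> S \<noteq> {}" using that by (auto simp: ideal_chains_def)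
    then show ?thesis using K_saturated[OF that] by blast
  qed
  have \<psi>_proper: "\<psi> S \<in> Pow V - {{}, V}" if "S \<subseteq> V" "a \<in> S \<longleftrightarrow> b \<in> S" for S
    using that ab unfolding \<psi>_def by auto
  have inj: "inj_on \<psi> (\<Union>K)"
  proof (rule inj_onI)
    fix S T assume "S \<in> \<Union>K" "T \<in> \<Union>K" and eq: "\<psi> S = \<psi> T"
    then have S: "S \<subseteq> V" "S \<noteq> {}" "a \<in> S \<longleftrightarrow> b \<in> S" and T: "T \<subseteq> V" "T \<noteq> {}" "a \<in> T \<longleftrightarrow> b \<in> T"
      using mem by blast+
    define h where "h X = (if X = {a} then V else if b \<in> X then X else X - {a})" for X
    have rec: "h (\<psi> S) = S" if "S \<subseteq> V" "S \<noteq> {}" "a \<in> S \<longleftrightarrow> b \<in> S" for S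
      using that ab unfolding \<psi>_def h_def by auto
    show "S = T" using rec[OF S] rec[OF T] unfolding eq by simp
  qed
  have img: "\<psi> ` C \<in> proper_chains V" if C: "C \<in> K" for C
  proof -
    have "chain\<^sub>\<subseteq> C" using C by (simp add: ideal_chains_def)
    have "chain\<^sub>\<subseteq> (\<psi> ` C)"
      unfolding chain_subset_def
    proof (intro ballI)
      fix A B assume "A \<in> \<psi> ` C" "B \<in> \<psi> ` C"
      then obtain S T where ST: "S \<in> C" "T \<in> C" "A = \<psi> S" "B = \<psi> T" by blast
      then have "S \<subseteq> T \<or> T \<subseteq> S" using \<open>chain\<^sub>\<subseteq> C\<close> by (auto simp: chain_subset_def)
      then show "A \<subseteq> B \<or> B \<subseteq> A" using ST unfolding \<psi>_def by auto
    qed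
    moreover have "\<psi> ` C \<subseteq> Pow V - {{}, V}"
      by (rule image_subsetI, rule \<psi>_proper) (use mem[OF C] in simp_all)
    ultimately show ?thesis by (simp add: proper_chains_def)
  qed
  have bd: "boundary_complex (coxeter_polytope V a) = (`) ?u ` proper_chains V"
    using boundary_complex_coxeter ab by blast
  have "\<psi> ` \<Union>K \<subseteq> Pow V - {{}, V}"
    by (rule image_subsetI, erule UnionE, rule \<psi>_proper) (use mem in simp_all)
  then have injc: "inj_on (?u \<circ> \<psi>) (\<Union>K)"
    by (intro comp_inj_on[OF inj] inj_on_subset[OF inj_on_coxeter_vertex])
  have "(`) (?u \<circ> \<psi>) ` K \<subseteq> boundary_complex (coxeter_polytope V a)"
    unfolding bd
  proof (rule image_subsetI)
    fix C assume "C \<in> K"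
    then show "(?u \<circ> \<psi>) ` C \<in> (`) ?u ` proper_chains V"
      unfolding image_comp[symmetric] by (rule imageI[OF img])
  qed
  moreover have "?u ` {{b}} \<in> boundary_complex (coxeter_polytope V a)"
    unfolding bd using ab by (intro imageI) (auto simp: proper_chains_def chain_subset_def)
  moreover have "?u ` {{b}} \<notin> (`) (?u \<circ> \<psi>) ` K"
  proof
    assume "?u ` {{b}} \<in> (`) (?u \<circ> \<psi>) ` K"
    then obtain C where C: "C \<in> K" "?u ` {{b}} = ?u ` \<psi> ` C" by (auto simp: image_comp)
    have "\<psi> ` C \<subseteq> Pow V - {{}, V}" using img[OF C(1)] by (simp add: proper_chains_def)
    moreover have "{{b}} \<subseteq> Pow V - {{}, V}" using ab by auto
    ultimately have "{{b}} = \<psi> ` C"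
      using C(2) inj_on_image_eq_iff[OF inj_on_coxeter_vertex[of V a]] by metis
    moreover have "a \<in> \<psi> S" for S by (simp add: \<psi>_def)
    ultimately show False using ab(3) by (metis imageE insertI1 singletonD)
  qed
  ultimately have "(`) (?u \<circ> \<psi>) ` K \<subset> boundary_complex (coxeter_polytope V a)" by blast
  then show ?thesis
    unfolding proper_in_polytope_boundary_def
    by (intro exI[of _ "coxeter_polytope V a"] exI[of _ "?u \<circ> \<psi>"] conjI
        simplicial_polytope_coxeter[OF ab(1)] injc)
qed

end

section \<open>Adding the edges one at a time\<close>

text \<open>The complex reached after the edges of \<open>F\<close> have been added: the Coxeter
  complex for \<open>F = {}\<close>, and the unipolar complex when \<open>F\<close> consists of all
  edges avoiding \<open>v\<close>.\<close>

definition colored_chains :: "'v set \<Rightarrow> 'v set set \<Rightarrow> 'v set set set" where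
  "colored_chains V F =
     {C. chain\<^sub>\<subseteq> C \<and> C \<subseteq> Pow V - {{}} \<and> (V \<notin> C \<or> (\<exists>e\<in>F. unsplit C e))}"

lemma colored_chains_empty: "colored_chains V {} = proper_chains V"
  unfolding colored_chains_def proper_chains_def by auto

lemma nat_injection:
  obtains r :: "'v::finite \<Rightarrow> nat" where "inj r"
  using finite_imp_inj_to_nat_seg[of "UNIV :: 'v set"] by auto

lemma pure_proper_chains:
  fixes V :: "'v::finite set"
  assumes "V \<noteq> {}"
  shows "pure_complex (int (card V) - 2) (proper_chains V)"
  unfolding pure_complex_def
proof (intro conjI ballI)
  show "abstract_complex (proper_chains V)"
    unfolding abstract_complex_def
  proof (intro conjI ballI allI impI)
    show "{} \<in> proper_chains V" by (simp add: proper_chains_def chain_subset_def)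
    fix C C' assume "C \<in> proper_chains V" "C' \<subseteq> C"
    then show "C' \<in> proper_chains V"
      using chain_subset_mono[of C C'] by (simp add: proper_chains_def subset_trans)
  qed
  fix G assume G: "G \<in> complex_facets (proper_chains V)"
  then have GP: "G \<in> proper_chains V"
    and maximal: "\<And>H. H \<in> proper_chains V \<Longrightarrow> G \<subseteq> H \<Longrightarrow> H = G"
    by (simp_all add: complex_facets_def)
  then have GI: "G \<in> ideal_chains V {}" by (auto simp: proper_chains_def ideal_chains_def)
  obtain r :: "'v \<Rightarrow> nat" where "inj r" by (rule nat_injection)
  \<comment> \<open>With no tied pair and no constraints, rankings are just injections, and the
    machinery for ears yields the maximal chains.\<close>
  then have r: "rank_fun V {} {} r" by (simp add: rank_fun_def inj_eq)
  obtain f where f: "rank_fun V {} {} f" "G \<subseteq> segments V f"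
    by (rule ideal_chain_extends[OF GI r]) simp_all
  have "segments V f \<in> ideal_chains V {}" by (rule segments_ideal[OF f(1)]) simp
  then have "segments V f - {V} \<in> proper_chains V"
    by (auto simp: ideal_chains_def proper_chains_def chain_subset_def)
  moreover have "G \<subseteq> segments V f - {V}" using f(2) GP by (auto simp: proper_chains_def)
  ultimately have "G = segments V f - {V}" using maximal by metis
  moreover have "card (segments V f) = card V"
  proof -
    have "inj_on f V" using f(1) by (auto simp: rank_fun_def inj_on_def)
    then show ?thesis by (simp add: card_segments card_image)
  qed
  moreover have "0 < card V" using assms by (simp add: card_gt_0_iff)
  ultimately show "int (card G) - 1 = int (card V) - 2"
    using V_in_segments[OF assms, of f] by simp
qed

text \<open>The dimension is a parameter here, so that ears can be appended without recomputing the
  dimension of the union; \<open>complex_dim A = d - 1\<close> is derived at the end.\<close>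

definition ear_sequence :: "int \<Rightarrow> 'a::finite set set \<Rightarrow> 'a set set list \<Rightarrow> bool" where
  "ear_sequence d A Ks \<longleftrightarrow> Ks \<noteq> [] \<and> (\<forall>j<length Ks. pure_complex (d - 1) (Ks ! j)) \<and>
     polytope_boundary d (Ks ! 0) \<and>
     (\<forall>j. 1 \<le> j \<and> j < length Ks \<longrightarrow>
        simplicial_ball (d - 1) (Ks ! j) \<and>
        proper_in_polytope_boundary d (Ks ! j) \<and>
        Ks ! j \<inter> (\<Union>i<j. Ks ! i) = ball_boundary (Ks ! j)) \<and>
     (\<Union>j<length Ks. Ks ! j) = A"

definition ear_over :: "int \<Rightarrow> 'a::finite set set \<Rightarrow> 'a set set \<Rightarrow> bool" where
  "ear_over d A K \<longleftrightarrow> pure_complex (d - 1) K \<and> simplicial_ball (d - 1) K \<and>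
     proper_in_polytope_boundary d K \<and> K \<inter> A = ball_boundary K"

lemma ear_sequence_append:
  assumes Ks: "ear_sequence d A Ks" and K: "ear_over d A K"
  shows "ear_sequence d (A \<union> K) (Ks @ [K])"
proof -
  let ?L = "Ks @ [K]"
  have old: "?L ! j = Ks ! j" if "j < length Ks" for j using that by (simp add: nth_append)
  have new: "?L ! length Ks = K" by simp
  have "Ks \<noteq> []" using Ks by (simp add: ear_sequence_def)
  have un: "(\<Union>i<j. ?L ! i) = (\<Union>i<j. Ks ! i)" if "j \<le> length Ks" for j
    using that by (intro SUP_cong) (auto simp: old)
  have UA: "(\<Union>i<length Ks. Ks ! i) = A" using Ks by (simp add: ear_sequence_def)
  have "pure_complex (d - 1) (?L ! j)" if "j < length ?L" for j
    using that Ks K old new by (cases "j = length Ks") (auto simp: ear_sequence_def ear_over_def)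
  moreover have "polytope_boundary d (?L ! 0)"
    using Ks \<open>Ks \<noteq> []\<close> by (simp add: old ear_sequence_def)
  moreover have "simplicial_ball (d - 1) (?L ! j) \<and> proper_in_polytope_boundary d (?L ! j) \<and>
      ?L ! j \<inter> (\<Union>i<j. ?L ! i) = ball_boundary (?L ! j)" if j: "1 \<le> j \<and> j < length ?L" for j
  proof (cases "j = length Ks")
    case True
    then show ?thesis using K UA un[of j] by (simp add: ear_over_def)
  next
    case False
    then have "j < length Ks" using j by simp
    then show ?thesis using Ks j un[of j] old[of j] by (simp add: ear_sequence_def)
  qed
  moreover have "(\<Union>j<length ?L. ?L ! j) = A \<union> K"
    using un[of "length Ks"] UA by (simp add: lessThan_Suc Un_commute)
  ultimately show ?thesis unfolding ear_sequence_def by blast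
qed

text \<open>Ears that meet each other only inside \<open>A\<close> can be appended in any order:
  those appended earlier add nothing to the intersection of the next one with the union.\<close>

lemma ear_sequence_family:
  assumes "finite \<K>" "ear_sequence d A Ks" "\<forall>K\<in>\<K>. ear_over d A K"
    and "\<forall>K\<in>\<K>. \<forall>K'\<in>\<K>. K \<noteq> K' \<longrightarrow> K \<inter> K' \<subseteq> A"
  shows "\<exists>Ks. ear_sequence d (A \<union> \<Union>\<K>) Ks"
  using assms
proof (induction \<K> rule: finite_induct)
  case empty
  then show ?case by auto
next
  case (insert K \<K>)
  then obtain Ls where Ls: "ear_sequence d (A \<union> \<Union>\<K>) Ls" by auto
  have sub: "K \<inter> K' \<subseteq> A" if "K' \<in> \<K>" for K'
    using insert.prems(3) insert.hyps(2) that by (metis insertI1 insertI2)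
  have "K \<inter> \<Union>\<K> \<subseteq> A"
  proof
    fix C assume "C \<in> K \<inter> \<Union>\<K>"
    then obtain K' where "K' \<in> \<K>" "C \<in> K \<inter> K'" by auto
    then show "C \<in> A" by (rule subsetD[OF sub])
  qed
  then have "K \<inter> (A \<union> \<Union>\<K>) = K \<inter> A" by auto
  then have "ear_over d (A \<union> \<Union>\<K>) K" using insert.prems(2) by (simp add: ear_over_def)
  from ear_sequence_append[OF Ls this] show ?case
    by (intro exI[of _ "Ls @ [K]"]) (simp add: Un_ac)
qed

lemma (in ear) ear_over_K: "ear_over (int (card V) - 1) (colored_chains V F) K"
proof -
  have "C \<in> colored_chains V F \<longleftrightarrow> V \<notin> C \<or> (\<exists>f\<in>F. unsplit C f)" if "C \<in> K" for C
    using that by (auto simp: colored_chains_def ideal_chains_def)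
  then have "K \<inter> colored_chains V F = ball_boundary K" unfolding ball_boundary_K by auto
  then show ?thesis
    unfolding ear_over_def
    using pure_K simplicial_ball_K proper_in_polytope_boundary_K by simp
qed

text \<open>A chain that splits every edge of \<open>F\<close> determines the orientation, because a
  member separating an edge contains its lower end. Distinct ears of one new edge can thus share
  only chains of the earlier complex.\<close>

lemma ear_precedes_subset:
  assumes "ear V F a b r" "ear V F a b r'"
    and C: "C \<in> ideal_chains V (ear.precedes F a b r)" "C \<in> ideal_chains V (ear.precedes F a b r')"
    and split: "\<forall>e\<in>F. \<not> unsplit C e"
  shows "ear.precedes F a b r \<subseteq> ear.precedes F a b r'"
proof
  interpret X: ear V F a b r by fact
  interpret Y: ear V F a b r' by fact
  fix x assume x: "x \<in> X.precedes"
  obtain p q where pq: "x = (p, q)" by (cases x)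
  show "x \<in> Y.precedes"
  proof (cases "{p, q} = {a, b}")
    case True
    then show ?thesis by (simp add: pq Y.precedes_def)
  next
    case False
    then have F: "{p, q} \<in> F" using x pq by (simp add: X.precedes_def)
    have V: "p \<in> V" "q \<in> V" using X.precedes_subset x pq by auto
    have "p \<noteq> q" using Y.edges(1)[OF F] by auto
    then have "r' p \<noteq> r' q" using Y.generic[OF V] False by simp
    obtain T where T: "T \<in> C" "\<not> {p, q} \<subseteq> T" "{p, q} \<inter> T \<noteq> {}"
      using split F unfolding unsplit_def by blast
    have "q \<in> T \<longrightarrow> p \<in> T" using C(1) T(1) x pq by (simp add: ideal_chains_def)
    then have pT: "p \<in> T" "q \<notin> T" using T by auto
    have "\<not> r' q < r' p"
    proof
      assume "r' q < r' p"
      then have "(q, p) \<in> Y.precedes" using F by (simp add: Y.precedes_def insert_commute)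
      then show False using C(2) T(1) pT by (simp add: ideal_chains_def)
    qed
    then show ?thesis using \<open>r' p \<noteq> r' q\<close> F pq by (simp add: Y.precedes_def)
  qed
qed

text \<open>Extend the chain to a ranking constrained only by the tie of \<open>a\<close> and
  \<open>b\<close>. That ranking serves itself as the generic point of the ear, and the chain
  consists of some of its initial segments.\<close>

lemma colored_chain_in_ear:
  fixes V :: "'v::finite set"
  assumes ab: "a \<in> V" "b \<in> V" "a \<noteq> b"
    and F: "\<And>f. f \<in> F \<Longrightarrow> f \<subseteq> V \<and> card f = 2" "{a, b} \<notin> F"
    and C: "chain\<^sub>\<subseteq> C" "C \<subseteq> Pow V - {{}}" "unsplit C {a, b}"
  obtains r where "ear V F a b r" "C \<in> ideal_chains V (ear.precedes F a b r)"
proof -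
  let ?g = "{(a, b), (b, a)}"
  obtain i :: "'v \<Rightarrow> nat" where "inj i" by (rule nat_injection)
  \<comment> \<open>An injection with the value at \<open>b\<close> redirected to that at
    \<open>a\<close> has exactly the required tie.\<close>
  then have r: "rank_fun V {a, b} ?g (i(b := i a))"
    using ab by (auto simp: rank_fun_def inj_eq doubleton_eq_iff)
  have sat: "{a, b} \<subseteq> T \<or> {a, b} \<inter> T = {}" if "T \<in> C" for T using C(3) that by (rule unsplitD)
  have CI: "C \<in> ideal_chains V ?g" using C(1,2) sat unfolding ideal_chains_def by auto
  obtain f where f: "rank_fun V {a, b} ?g f" "C \<subseteq> segments V f"
    by (rule ideal_chain_extends[OF CI r sat])
  have ear: "ear V F a b f"
    using ab F f(1) by unfold_locales (auto simp: rank_fun_def)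
  interpret ear V F a b f by (rule ear)
  show ?thesis by (rule that[OF ear]) (rule K_subset[OF segments_in_K[OF ranking_r] f(2)])
qed

lemma ear_sequence_edge:
  fixes V :: "'v::finite set"
  assumes e: "e \<subseteq> V" "card e = 2" "e \<notin> F"
    and F: "\<And>f. f \<in> F \<Longrightarrow> f \<subseteq> V \<and> card f = 2"
    and Ks: "ear_sequence (int (card V) - 1) (colored_chains V F) Ks"
  shows "\<exists>Ks. ear_sequence (int (card V) - 1) (colored_chains V (insert e F)) Ks"
proof -
  obtain a b where e_def: "e = {a, b}" "a \<noteq> b" using e(2) by (meson card_2_iff)
  have ab: "a \<in> V" "b \<in> V" "{a, b} \<notin> F" using e e_def by auto
  let ?K = "\<lambda>r. ideal_chains V (ear.precedes F a b r)"
  \<comment> \<open>Rankings that orient \<open>F\<close> alike give the same ear; taking the image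
    counts each ear once and makes the family finite.\<close>
  let ?\<K> = "?K ` {r. ear V F a b r}"
  have over: "\<forall>K\<in>?\<K>. ear_over (int (card V) - 1) (colored_chains V F) K"
    using ear.ear_over_K by auto
  have disj: "\<forall>K\<in>?\<K>. \<forall>K'\<in>?\<K>. K \<noteq> K' \<longrightarrow> K \<inter> K' \<subseteq> colored_chains V F"
  proof (intro ballI impI subsetI, rule ccontr)
    fix K K' C assume K: "K \<in> ?\<K>" "K' \<in> ?\<K>" "K \<noteq> K'" "C \<in> K \<inter> K'" "C \<notin> colored_chains V F"
    then obtain r r' where r: "ear V F a b r" "ear V F a b r'" "K = ?K r" "K' = ?K r'" by auto
    have C: "C \<in> ?K r" "C \<in> ?K r'" using K r by auto
    then have split: "\<forall>e\<in>F. \<not> unsplit C e"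
      using K(5) by (auto simp: colored_chains_def ideal_chains_def)
    have "ear.precedes F a b r = ear.precedes F a b r'"
      using ear_precedes_subset[OF r(1,2) C split] ear_precedes_subset[OF r(2,1) C(2,1) split]
      by (rule subset_antisym)
    then show False using K(3) r by simp
  qed
  have "colored_chains V F \<union> \<Union>?\<K> = colored_chains V (insert e F)"
  proof (intro equalityI subsetI)
    fix C assume "C \<in> colored_chains V F \<union> \<Union>?\<K>"
    then consider "C \<in> colored_chains V F" | r where "ear V F a b r" "C \<in> ?K r" by auto
    then show "C \<in> colored_chains V (insert e F)"
    proof cases
      case 1
      then show ?thesis by (auto simp: colored_chains_def)
    next
      case 2
      then have "unsplit C e" using ear.K_saturated[OF 2] by (simp add: unsplit_def e_def)
      then show ?thesis using 2(2) by (simp add: colored_chains_def ideal_chains_def)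
    qed
  next
    fix C assume C: "C \<in> colored_chains V (insert e F)"
    show "C \<in> colored_chains V F \<union> \<Union>?\<K>"
    proof (cases "C \<in> colored_chains V F")
      case False
      then have "chain\<^sub>\<subseteq> C" "C \<subseteq> Pow V - {{}}" "unsplit C {a, b}"
        using C by (auto simp: colored_chains_def e_def)
      then obtain r where "ear V F a b r" "C \<in> ?K r"
        using colored_chain_in_ear[OF ab(1,2) e_def(2) F ab(3)] by blast
      then show ?thesis by auto
    qed simp
  qed
  then show ?thesis using ear_sequence_family[OF _ Ks over disj] by simp
qed

lemma ear_sequence_colored_chains:
  fixes V :: "'v::finite set"
  assumes "V \<noteq> {}" "\<And>f. f \<in> F \<Longrightarrow> f \<subseteq> V \<and> card f = 2"
  shows "\<exists>Ks. ear_sequence (int (card V) - 1) (colored_chains V F) Ks"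
proof -
  have "finite F" by simp
  then show ?thesis
    using assms(2)
  proof (induction F rule: finite_induct)
    case empty
    have "ear_sequence (int (card V) - 1) (colored_chains V {}) [proper_chains V]"
      using pure_proper_chains[OF assms(1)] polytope_boundary_proper_chains[OF assms(1)]
      by (simp add: ear_sequence_def colored_chains_empty lessThan_Suc)
    then show ?case by blast
  next
    case (insert e F)
    then obtain Ks where "ear_sequence (int (card V) - 1) (colored_chains V F) Ks" by blast
    then show ?case using insert by (intro ear_sequence_edge) auto
  qed
qed

lemma face_in_facet:
  fixes K :: "'a::finite set set"
  assumes "C \<in> K"
  obtains G where "G \<in> complex_facets K" "C \<subseteq> G"
proof -
  have "finite K" by simp
  from finite_has_maximal2[OF this assms]
  obtain G where "G \<in> K" "C \<subseteq> G" "\<forall>H\<in>K. G \<subseteq> H \<longrightarrow> G = H" by auto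
  then have "G \<in> complex_facets K" by (auto simp: complex_facets_def)
  then show ?thesis using \<open>C \<subseteq> G\<close> by (rule that)
qed

text \<open>What remains is the dimension: every face lies in a facet of one of the pure
  subcomplexes, so it has at most \<open>d\<close> elements, and the facets attain this
  number.\<close>

lemma ear_sequence_imp_decomposition:
  assumes Ks: "ear_sequence d A Ks"
  shows "convex_ear_decomposition A Ks"
proof -
  have ne: "0 < length Ks" using Ks by (simp add: ear_sequence_def)
  have UA: "(\<Union>j<length Ks. Ks ! j) = A" using Ks by (simp add: ear_sequence_def)
  have pure: "pure_complex (d - 1) (Ks ! j)" if "j < length Ks" for j
    using Ks that by (simp add: ear_sequence_def)
  have sub: "Ks ! j \<subseteq> A" if "j < length Ks" for j using UA that by blast
  have abs_j: "{} \<in> Ks ! j" "\<And>F F'. F \<in> Ks ! j \<Longrightarrow> F' \<subseteq> F \<Longrightarrow> F' \<in> Ks ! j" if "j < length Ks" for j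
    using pure[OF that] by (auto simp: pure_complex_def abstract_complex_def)
  have "abstract_complex A"
    unfolding abstract_complex_def
  proof (intro conjI ballI allI impI)
    show "{} \<in> A" using abs_j(1)[OF ne] sub[OF ne] by blast
    fix F F' assume "F \<in> A" "F' \<subseteq> F"
    then obtain j where "j < length Ks" "F \<in> Ks ! j" using UA by blast
    then show "F' \<in> A" using abs_j(2) sub \<open>F' \<subseteq> F\<close> by blast
  qed
  moreover have "complex_dim A + 1 = d"
  proof -
    have le: "int (card C) \<le> d" if "C \<in> A" for C
    proof -
      obtain j where j: "j < length Ks" "C \<in> Ks ! j" using UA \<open>C \<in> A\<close> by blast
      then obtain G where G: "G \<in> complex_facets (Ks ! j)" "C \<subseteq> G" by (blast elim: face_in_facet)
      then have "int (card G) = d" using pure[OF j(1)] by (auto simp: pure_complex_def)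
      then show ?thesis using card_mono[OF _ G(2)] by simp
    qed
    obtain G where G: "G \<in> complex_facets (Ks ! 0)" using abs_j(1)[OF ne] by (blast elim: face_in_facet)
    then have "int (card G) = d" "G \<in> A"
      using pure[OF ne] sub[OF ne] by (auto simp: pure_complex_def complex_facets_def)
    then have "Max (card ` A) = card G" using le by (intro Max_eqI) force+
    then show ?thesis using \<open>int (card G) = d\<close> by (simp add: complex_dim_def)
  qed
  ultimately show ?thesis
    using Ks sub unfolding convex_ear_decomposition_def ear_sequence_def by (simp add: Let_def)
qed

section \<open>Chains as lists of disjoint blocks\<close>

lemma list_chain_Nil: "list_chain [] = {}"
  by (simp add: list_chain_def)

lemma list_chain_snoc: "list_chain (Ss @ [B]) = insert (\<Union>(set Ss) \<union> B) (list_chain Ss)"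
proof -
  have "{1..length (Ss @ [B])} = insert (Suc (length Ss)) {1..length Ss}" by auto
  then show ?thesis by (auto simp: list_chain_def)
qed

text \<open>The blocks are the successive differences of the chain. The last one is nonempty because
  the union of the smaller members is itself a smaller member, or empty if there are none.\<close>

lemma chain_eq_list_chain:
  fixes C :: "'v::finite set set"
  assumes "chain\<^sub>\<subseteq> C" "{} \<notin> C"
  shows "\<exists>Ss. list_chain Ss = C \<and> (\<forall>S\<in>set Ss. S \<noteq> {}) \<and>
    sorted_wrt (\<lambda>A B. A \<inter> B = {}) Ss \<and> \<Union>(set Ss) = \<Union>C"
  using assms
proof (induction "card C" arbitrary: C)
  case 0
  then have "C = {}" by simp
  then show ?case by (intro exI[of _ "[]"]) (simp add: list_chain_Nil)
next
  case (Suc n)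
  let ?M = "\<Union>C"
  let ?C = "C - {?M}"
  have M: "?M \<in> C" using Suc by (intro chain_Union_mem) auto
  have "card ?C = n" using Suc M by simp
  moreover have chain: "chain\<^sub>\<subseteq> ?C" using Suc.prems(1) chain_subset_mono by blast
  ultimately obtain Ss where Ss: "list_chain Ss = ?C" "\<forall>S\<in>set Ss. S \<noteq> {}"
    "sorted_wrt (\<lambda>A B. A \<inter> B = {}) Ss" "\<Union>(set Ss) = \<Union>?C"
    using Suc.hyps(1)[of ?C] Suc.prems(2) by auto
  have "\<Union>?C \<noteq> ?M"
  proof (cases "?C = {}")
    case True
    then have "\<Union>?C = {}" by (simp only: Union_empty)
    then show ?thesis using M Suc.prems(2) by metis
  next
    case False
    then show ?thesis using chain_Union_mem[OF chain False] by auto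
  qed
  moreover define U where "U = \<Union>?C"
  moreover have "U \<subseteq> ?M" unfolding U_def by (rule Union_mono) simp
  ultimately have ne: "?M - U \<noteq> {}" and union: "U \<union> (?M - U) = ?M" by auto
  have "list_chain (Ss @ [?M - U]) = insert ?M ?C"
    using Ss(1,4) union by (simp add: list_chain_snoc U_def)
  also have "insert ?M ?C = C" using M by (rule insert_Diff)
  finally have "list_chain (Ss @ [?M - U]) = C" .
  moreover have "\<forall>S\<in>set (Ss @ [?M - U]). S \<noteq> {}" using Ss(2) ne by simp
  moreover have "sorted_wrt (\<lambda>A B. A \<inter> B = {}) (Ss @ [?M - U])"
  proof -
    have "S \<inter> (?M - U) = {}" if "S \<in> set Ss" for S using Ss(4) that unfolding U_def by auto
    then show ?thesis using Ss(3) by (simp add: sorted_wrt_append)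
  qed
  moreover have "\<Union>(set (Ss @ [?M - U])) = ?M" using Ss(4) union by (simp add: U_def Un_commute)
  ultimately show ?case by (intro exI[of _ "Ss @ [?M - U]"] conjI)
qed

section \<open>The unipolar complex\<close>

lemma chain_list_chain: "chain\<^sub>\<subseteq> (list_chain Ss)"
  unfolding chain_subset_def
proof (intro ballI)
  fix A B assume "A \<in> list_chain Ss" "B \<in> list_chain Ss"
  then obtain i j where "A = \<Union>(set (take i Ss))" "B = \<Union>(set (take j Ss))"
    by (auto simp: list_chain_def)
  moreover have "set (take i Ss) \<subseteq> set (take j Ss) \<or> set (take j Ss) \<subseteq> set (take i Ss)"
    using set_take_subset_set_take nat_le_linear by metis
  ultimately show "A \<subseteq> B \<or> B \<subseteq> A" by (auto intro: Union_mono)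
qed

lemma list_chain_mem:
  assumes "T \<in> list_chain Ss" "\<forall>S\<in>set Ss. S \<noteq> {}"
  shows "T \<noteq> {}" "T \<subseteq> \<Union>(set Ss)"
proof -
  obtain k where k: "1 \<le> k" "k \<le> length Ss" "T = \<Union>(set (take k Ss))"
    using assms(1) by (auto simp: list_chain_def)
  then have "Ss ! 0 \<in> set (take k Ss)"
    by (metis One_nat_def Suc_le_eq length_take min.absorb2 nth_mem nth_take)
  moreover have sub: "set (take k Ss) \<subseteq> set Ss" by (rule set_take_subset)
  ultimately show "T \<noteq> {}" using assms(2) k(3) by auto
  show "T \<subseteq> \<Union>(set Ss)" unfolding k(3) using sub by (rule Union_mono)
qed

text \<open>A prefix of the list either includes the block \<open>S\<close> or consists of blocks
  disjoint from it.\<close>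

lemma unsplit_list_chain:
  assumes disj: "sorted_wrt (\<lambda>A B. A \<inter> B = {}) Ss" and S: "S \<in> set Ss" "e \<subseteq> S"
  shows "unsplit (list_chain Ss) e"
  unfolding unsplit_def
proof
  fix T assume "T \<in> list_chain Ss"
  then obtain j where T: "T = \<Union>(set (take j Ss))" by (auto simp: list_chain_def)
  obtain k where k: "k < length Ss" "S = Ss ! k" using S(1) by (metis in_set_conv_nth)
  show "e \<subseteq> T \<or> e \<inter> T = {}"
  proof (cases "k < j")
    case True
    then have "S \<in> set (take j Ss)" using k by (auto simp: in_set_conv_nth intro!: exI[of _ k])
    then show ?thesis using S(2) T by auto
  next
    case False
    have "A \<inter> S = {}" if A: "A \<in> set (take j Ss)" for A
    proof -
      obtain i where "i < j" "i < length Ss" "A = Ss ! i" using A by (auto simp: in_set_conv_nth)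
      then show ?thesis using disj k False by (auto simp: sorted_wrt_iff_nth_less)
    qed
    then show ?thesis using S(2) T by auto
  qed
qed

text \<open>Appending \<open>B\<close> divides the complementary last block in two. An edge inside
  that block falls into one of the parts, since the new member does not split it.\<close>

lemma unsplit_list_chain_block:
  assumes "unsplit (list_chain Ss) e" "e \<noteq> {}"
  shows "\<exists>S\<in>set (Ss @ [UNIV - \<Union>(set Ss)]). e \<subseteq> S"
  using assms
proof (induction Ss rule: rev_induct)
  case Nil
  then show ?case by simp
next
  case (snoc B Ss)
  have "unsplit (list_chain Ss) e" using snoc.prems(1) by (simp add: list_chain_snoc unsplit_def)
  then obtain S where S: "S \<in> set (Ss @ [UNIV - \<Union>(set Ss)])" "e \<subseteq> S"
    using snoc.IH snoc.prems(2) by blast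
  show ?case
  proof (cases "S \<in> set Ss")
    case True
    then show ?thesis using S(2) by (intro bexI[of _ S]) simp_all
  next
    case False
    then have "e \<subseteq> UNIV - \<Union>(set Ss)" using S by simp
    moreover have "e \<subseteq> \<Union>(set Ss) \<union> B \<or> e \<inter> (\<Union>(set Ss) \<union> B) = {}"
      using snoc.prems(1) by (simp add: list_chain_snoc unsplit_def)
    ultimately have "e \<subseteq> B \<or> e \<subseteq> UNIV - \<Union>(set (Ss @ [B]))" by auto
    then show ?thesis by auto
  qed
qed

text \<open>If the blocks do not exhaust the vertices other than \<open>v\<close>, some
  \<open>u\<close> is left together with \<open>v\<close> in the complementary block, which then
  contains the edge \<open>{v, u}\<close>. If they do, that block is \<open>{v}\<close> alone, and
  only edges avoiding \<open>v\<close> can lie in a block.\<close>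

lemma unipolar_complex_eq_colored_chains:
  fixes E :: "'v::finite set set"
  assumes E: "simple_graph E" and full: "\<And>u. u \<noteq> v \<Longrightarrow> {v, u} \<in> E"
    and nonempty: "UNIV - {v} \<noteq> {}"
  shows "unipolar_complex E v = colored_chains (UNIV - {v}) {e \<in> E. v \<notin> e}"
proof (intro equalityI subsetI)
  fix C assume "C \<in> unipolar_complex E v"
  then obtain Ss where Ss: "coloring_face E Ss" "v \<notin> \<Union>(set Ss)" and C: "C = list_chain Ss"
    by (auto simp: unipolar_complex_def)
  have ne: "\<forall>S\<in>set Ss. S \<noteq> {}" and disj: "sorted_wrt (\<lambda>A B. A \<inter> B = {}) Ss"
    using Ss(1) by (simp_all add: coloring_face_def)
  obtain S e where S: "S \<in> set (Ss @ [UNIV - \<Union>(set Ss)])" and e: "e \<in> E" "e \<subseteq> S"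
    using Ss(1) by (auto simp: coloring_face_def)
  have mem: "T \<noteq> {} \<and> T \<subseteq> UNIV - {v}" if "T \<in> C" for T
    using list_chain_mem[of T Ss, OF _ ne] that C Ss(2) by blast
  have "UNIV - {v} \<notin> C \<or> (\<exists>e\<in>{e \<in> E. v \<notin> e}. unsplit C e)"
  proof (cases "S \<in> set Ss")
    case True
    then have "unsplit C e" unfolding C using disj e(2) by (intro unsplit_list_chain)
    moreover have "v \<notin> e" using True Ss(2) e(2) by blast
    ultimately show ?thesis using e(1) by blast
  next
    case False
    then have e': "e \<inter> \<Union>(set Ss) = {}" using S e(2) by auto
    have disjoint: "e \<inter> T = {}" if "T \<in> C" for T
      using list_chain_mem(2)[of T Ss, OF _ ne] that C e' by blast
    show ?thesis
    proof (cases "v \<in> e")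
      case True
      have "card e = 2" using E e(1) by (simp add: simple_graph_def)
      then obtain x y where "e = {x, y}" "x \<noteq> y" by (meson card_2_iff)
      then obtain u where "u \<in> e" "u \<noteq> v" by auto
      \<comment> \<open>The other end \<open>u\<close> of an edge at \<open>v\<close> lies in no
        member of the chain, so \<open>UNIV - {v}\<close> is not a member.\<close>
      then show ?thesis using disjoint[of "UNIV - {v}"] by auto
    next
      case False
      moreover have "unsplit C e" using disjoint by (simp add: unsplit_def)
      ultimately show ?thesis using e(1) by blast
    qed
  qed
  moreover have "chain\<^sub>\<subseteq> C" unfolding C by (rule chain_list_chain)
  moreover have "C \<subseteq> Pow (UNIV - {v}) - {{}}" using mem by auto
  ultimately show "C \<in> colored_chains (UNIV - {v}) {e \<in> E. v \<notin> e}"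
    by (simp add: colored_chains_def)
next
  fix C assume C: "C \<in> colored_chains (UNIV - {v}) {e \<in> E. v \<notin> e}"
  then have chain: "chain\<^sub>\<subseteq> C" "{} \<notin> C" by (auto simp: colored_chains_def)
  from chain_eq_list_chain[OF this] obtain Ss where Ss: "list_chain Ss = C"
    "\<forall>S\<in>set Ss. S \<noteq> {}" "sorted_wrt (\<lambda>A B. A \<inter> B = {}) Ss" "\<Union>(set Ss) = \<Union>C" by auto
  have v: "v \<notin> \<Union>(set Ss)" using C Ss(4) by (auto simp: colored_chains_def)
  have "\<exists>S\<in>set (Ss @ [UNIV - \<Union>(set Ss)]). \<exists>e\<in>E. e \<subseteq> S"
  proof (cases "\<exists>e\<in>E. v \<notin> e \<and> unsplit C e")
    case True
    then obtain e where e: "e \<in> E" "unsplit C e" by blast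
    have "e \<noteq> {}" using E e(1) by (auto simp: simple_graph_def)
    then show ?thesis using unsplit_list_chain_block[of Ss e] e Ss(1) by blast
  next
    case False
    then have V: "UNIV - {v} \<notin> C" using C by (auto simp: colored_chains_def)
    have "\<Union>C \<noteq> UNIV - {v}"
      using chain_Union_mem[OF chain(1)] V nonempty by (cases "C = {}") auto
    moreover have "\<Union>C \<subseteq> UNIV - {v}" using v Ss(4) by auto
    ultimately obtain u where "u \<in> UNIV - {v}" "u \<notin> \<Union>C" by (meson subsetI subset_antisym)
    then have u: "u \<noteq> v" "u \<notin> \<Union>(set Ss)" using Ss(4) by simp_all
    then have "{v, u} \<subseteq> UNIV - \<Union>(set Ss)" using v by simp
    moreover have "{v, u} \<in> E" using full u(1) by simp
    ultimately show ?thesis by (intro bexI[of _ "UNIV - \<Union>(set Ss)"] bexI[of _ "{v, u}"]) simp_all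
  qed
  moreover have "\<Union>(set Ss) \<noteq> UNIV" using v by blast
  ultimately have "coloring_face E Ss" using Ss(2,3) by (simp add: coloring_face_def)
  then show "C \<in> unipolar_complex E v" using v Ss(1) by (auto simp: unipolar_complex_def)
qed

text \<open>The edges at \<open>v\<close> are among the \<open>CARD('v) - 1\<close> pairs
  \<open>{v, u}\<close>, and equal cardinality makes the two sets coincide.\<close>

lemma full_degree_adjacent:
  fixes E :: "'v::finite set set"
  assumes "simple_graph E" "vdegree E v = CARD('v) - 1" "u \<noteq> v"
  shows "{v, u} \<in> E"
proof -
  let ?N = "(\<lambda>u. {v, u}) ` (UNIV - {v})"
  have "{e \<in> E. v \<in> e} \<subseteq> ?N"
  proof
    fix e assume e: "e \<in> {e \<in> E. v \<in> e}"
    then have "card e = 2" using assms(1) by (simp add: simple_graph_def)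
    then obtain x y where "e = {x, y}" "x \<noteq> y" by (meson card_2_iff)
    then show "e \<in> ?N" using e by (auto simp: insert_commute)
  qed
  moreover have "card ?N = CARD('v) - 1"
    by (subst card_image) (auto simp: inj_on_def doubleton_eq_iff card_Diff_singleton)
  ultimately have "{e \<in> E. v \<in> e} = ?N"
    using assms(2) by (intro card_subset_eq) (auto simp: vdegree_def)
  then show ?thesis using assms(3) by blast
qed

theorem theorem4p1:
  fixes E :: "'v::finite set set" and v :: 'v
  assumes "simple_graph E"
    and "CARD('v) \<ge> 2"
    and "vdegree E v = CARD('v) - 1"
  shows "\<exists>Ks. convex_ear_decomposition (unipolar_complex E v) Ks"
proof -
  let ?V = "UNIV - {v}" and ?F = "{e \<in> E. v \<notin> e}"
  have "card ?V = CARD('v) - 1" by (simp add: card_Diff_singleton)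
  then have ne: "?V \<noteq> {}" using assms(2) by force
  have edges: "f \<subseteq> ?V \<and> card f = 2" if "f \<in> ?F" for f
    using assms(1) that by (auto simp: simple_graph_def)
  obtain Ks where "ear_sequence (int (card ?V) - 1) (colored_chains ?V ?F) Ks"
    using ear_sequence_colored_chains[OF ne edges] by (rule exE)
  moreover have "unipolar_complex E v = colored_chains ?V ?F"
    using full_degree_adjacent[OF assms(1,3)]
    by (intro unipolar_complex_eq_colored_chains assms(1) ne)
  ultimately have "convex_ear_decomposition (unipolar_complex E v) Ks"
    using ear_sequence_imp_decomposition by metis
  then show ?thesis by (rule exI)
qed

end
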